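(* Let $n\ge 2$ and let $H$ be an $n\times n$ complex matrix which has $n$ different eigenvalues. Then the compact subset $$M=\{z=(z_1,\dots,z_n)\in \mathbf{SU}(n)\ |\ z_1^tH\bar z_2=0\}$$ of the special unitary group $\mathbf{SU}(n)$ is a minimal submanifold of codimension two.
   Context: $\mathbf{SU}(n)$ is the special unitary group of $n\times n$ complex matrices $z$ with $zz^*=I$ and $\det z=1$, equipped with the bi-invariant Riemannian metric induced by the inner product $\langle X,Y\rangle=\operatorname{trace}(XY^* )$ on its Lie algebra $\mathfrak{su}(n)$ (trace-free skew-Hermitian matrices). For $z\in\mathbf{SU}(n)$, $z_1,\dots,z_n\in\mathbb{C}^n$ denote the columns of $z$, and one writes $z=(z_1,\dots,z_n)$; $z_1^t$ is the transpose of the column $z_1$ and $\bar z_2$ the entrywise complex conjugate of the column $z_2$. "Codimension two" means real codimension two in the real manifold $\mathbf{SU}(n)$. A submanifold of a Riemannian manifold is minimal if its mean curvature vector field (the trace of its second fundamental form) vanishes identically. *)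

theory Defs
  imports "HOL-Analysis.Analysis"
begin

section \<open>Smooth maps and embedded submanifolds of Euclidean spaces\<close>

text \<open>
  \<open>Ck_on k U f\<close> says that \<open>f\<close> is of class \<open>C^k\<close> on the open set \<open>U\<close>. In finite dimensions it is
  enough to control the directional derivatives for each fixed direction \<open>v\<close>.
\<close>

primrec Ck_on ::
  "nat \<Rightarrow> 'a::euclidean_space set \<Rightarrow> ('a \<Rightarrow> 'b::euclidean_space) \<Rightarrow> bool" where
  "Ck_on 0 U f \<longleftrightarrow> continuous_on U f"
| "Ck_on (Suc k) U f \<longleftrightarrow>
     (\<forall>x\<in>U. f differentiable (at x)) \<and> (\<forall>v. Ck_on k U (\<lambda>x. frechet_derivative f (at x) v))"

definition smooth_on_open ::
  "'a::euclidean_space set \<Rightarrow> ('a \<Rightarrow> 'b::euclidean_space) \<Rightarrow> bool" where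
  "smooth_on_open U f \<longleftrightarrow> open U \<and> (\<forall>k. Ck_on k U f)"

text \<open>
  Smoothness on an arbitrary subset: local extendability to smooth maps on open sets. On an embedded
  submanifold this is the usual notion of a smooth map. Only the values on \<open>S\<close> matter.
\<close>

definition smooth_map_on ::
  "'a::euclidean_space set \<Rightarrow> ('a \<Rightarrow> 'b::euclidean_space) \<Rightarrow> bool" where
  "smooth_map_on S f \<longleftrightarrow>
     (\<forall>p\<in>S. \<exists>U h. p \<in> U \<and> smooth_on_open U h \<and> (\<forall>q\<in>S \<inter> U. h q = f q))"

text \<open>Embedded \<open>d\<close>-dimensional submanifolds without boundary, by slice charts.\<close>

definition embedded_submanifold :: "nat \<Rightarrow> 'a::euclidean_space set \<Rightarrow> bool" where
  "embedded_submanifold d M \<longleftrightarrow>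
     (\<forall>p\<in>M. \<exists>U V \<phi> \<psi> L.
        p \<in> U \<and> smooth_on_open U (\<phi> :: 'a \<Rightarrow> 'a) \<and> smooth_on_open V (\<psi> :: 'a \<Rightarrow> 'a) \<and>
        homeomorphism U V \<phi> \<psi> \<and> subspace L \<and> dim L = d \<and> \<phi> ` (U \<inter> M) = V \<inter> L)"

text \<open>
  A subset of an embedded submanifold \<open>S\<close> is an embedded submanifold of \<open>S\<close> if and only if it is an
  embedded submanifold of the surrounding Euclidean space.
\<close>

definition submanifold_of_codim :: "nat \<Rightarrow> 'a::euclidean_space set \<Rightarrow> 'a set \<Rightarrow> bool" where
  "submanifold_of_codim k S M \<longleftrightarrow>
     M \<subseteq> S \<and> (\<exists>d. embedded_submanifold (d + k) S \<and> embedded_submanifold d M)"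

text \<open>The tangent space as the set of velocities of curves in \<open>S\<close>.\<close>

definition tangent_space :: "'a::euclidean_space set \<Rightarrow> 'a \<Rightarrow> 'a set" where
  "tangent_space S p =
     {v. \<exists>c. c 0 = p \<and> (\<forall>t::real. c t \<in> S) \<and> (c has_vector_derivative v) (at 0)}"

text \<open>
  The derivative of \<open>f\<close>, given on \<open>S\<close>, in a direction \<open>v\<close> tangent to \<open>S\<close> at \<open>p\<close>. A derivative
  within \<open>S\<close> is in general not unique as a linear map, but its values on \<open>tangent_space S p\<close> are.
\<close>

definition tangential_derivative ::
  "'a::euclidean_space set \<Rightarrow> ('a \<Rightarrow> 'b::euclidean_space) \<Rightarrow> 'a \<Rightarrow> 'a \<Rightarrow> 'b" where
  "tangential_derivative S f p v =
     (THE w. \<exists>D. (f has_derivative D) (at p within S) \<and> w = D v)"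


section \<open>Riemannian geometry of an embedded submanifold with a metric\<close>

text \<open>
  A Riemannian metric on \<open>S\<close> is a function \<open>g\<close> such that \<open>g p\<close> is an inner product on
  \<open>tangent_space S p\<close> for \<open>p \<in> S\<close>; it need not be the one induced from the surrounding space.
\<close>

definition vector_field :: "'a::euclidean_space set \<Rightarrow> ('a \<Rightarrow> 'a) \<Rightarrow> bool" where
  "vector_field S X \<longleftrightarrow> smooth_map_on S X \<and> (\<forall>p\<in>S. X p \<in> tangent_space S p)"

text \<open>The commutator \<open>[X, Y] f = X (Y f) - Y (X f)\<close>, in Euclidean coordinates.\<close>

definition lie_bracket ::
  "'a::euclidean_space set \<Rightarrow> ('a \<Rightarrow> 'a) \<Rightarrow> ('a \<Rightarrow> 'a) \<Rightarrow> 'a \<Rightarrow> 'a" where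
  "lie_bracket S X Y p = tangential_derivative S Y p (X p) - tangential_derivative S X p (Y p)"

locale levi_civita_connection =
  fixes S :: "'a::euclidean_space set"
    and g :: "'a \<Rightarrow> 'a \<Rightarrow> 'a \<Rightarrow> real"
    and N :: "('a \<Rightarrow> 'a) \<Rightarrow> ('a \<Rightarrow> 'a) \<Rightarrow> 'a \<Rightarrow> 'a"
  assumes field: "vector_field S X \<Longrightarrow> vector_field S Y \<Longrightarrow> vector_field S (N X Y)"
    and add_left:
      "vector_field S X \<Longrightarrow> vector_field S X' \<Longrightarrow> vector_field S Y \<Longrightarrow> p \<in> S \<Longrightarrow>
         N (\<lambda>q. X q + X' q) Y p = N X Y p + N X' Y p"
    and scale_left:
      "smooth_map_on S f \<Longrightarrow> vector_field S X \<Longrightarrow> vector_field S Y \<Longrightarrow> p \<in> S \<Longrightarrow>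
         N (\<lambda>q. f q *\<^sub>R X q) Y p = f p *\<^sub>R N X Y p"
    and add_right:
      "vector_field S X \<Longrightarrow> vector_field S Y \<Longrightarrow> vector_field S Y' \<Longrightarrow> p \<in> S \<Longrightarrow>
         N X (\<lambda>q. Y q + Y' q) p = N X Y p + N X Y' p"
    and leibniz:
      "smooth_map_on S f \<Longrightarrow> vector_field S X \<Longrightarrow> vector_field S Y \<Longrightarrow> p \<in> S \<Longrightarrow>
         N X (\<lambda>q. f q *\<^sub>R Y q) p = tangential_derivative S f p (X p) *\<^sub>R Y p + f p *\<^sub>R N X Y p"
    and torsion_free:
      "vector_field S X \<Longrightarrow> vector_field S Y \<Longrightarrow> p \<in> S \<Longrightarrow>
         N X Y p - N Y X p = lie_bracket S X Y p"
    and metric: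
      "vector_field S X \<Longrightarrow> vector_field S Y \<Longrightarrow> vector_field S Z \<Longrightarrow> p \<in> S \<Longrightarrow>
         tangential_derivative S (\<lambda>q. g q (Y q) (Z q)) p (X p) =
           g p (N X Y p) (Z p) + g p (Y p) (N X Z p)"

text \<open>
  By the fundamental theorem of Riemannian geometry a Levi-Civita connection exists and is unique
  on vector fields and at points of \<open>S\<close>; nothing below depends on its other values.
\<close>

definition levi_civita ::
  "'a::euclidean_space set \<Rightarrow> ('a \<Rightarrow> 'a \<Rightarrow> 'a \<Rightarrow> real) \<Rightarrow> ('a \<Rightarrow> 'a) \<Rightarrow> ('a \<Rightarrow> 'a) \<Rightarrow> 'a \<Rightarrow> 'a" where
  "levi_civita S g = (SOME N. levi_civita_connection S g N)"

text \<open>The component of \<open>w\<close>, tangent to \<open>S\<close> at \<open>p\<close>, that is \<open>g\<close>-orthogonal to \<open>M\<close>.\<close>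

definition normal_component ::
  "'a::euclidean_space set \<Rightarrow> ('a \<Rightarrow> 'a \<Rightarrow> 'a \<Rightarrow> real) \<Rightarrow> 'a set \<Rightarrow> 'a \<Rightarrow> 'a \<Rightarrow> 'a" where
  "normal_component S g M p w =
     (THE u. u \<in> tangent_space S p \<and> w - u \<in> tangent_space M p \<and>
             (\<forall>v\<in>tangent_space M p. g p u v = 0))"

text \<open>
  The second fundamental form of \<open>M\<close> in \<open>(S, g)\<close> at \<open>p\<close>: the normal component of the covariant
  derivative of \<open>Y\<close> along \<open>X\<close>, where \<open>X\<close> and \<open>Y\<close> are vector fields on \<open>S\<close>, tangent to \<open>M\<close>
  along \<open>M\<close>, that extend \<open>v\<close> and \<open>w\<close>. It does not depend on the choice of \<open>X\<close> and \<open>Y\<close>.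
\<close>

definition second_fundamental_form ::
  "'a::euclidean_space set \<Rightarrow> ('a \<Rightarrow> 'a \<Rightarrow> 'a \<Rightarrow> real) \<Rightarrow> 'a set \<Rightarrow> 'a \<Rightarrow> 'a \<Rightarrow> 'a \<Rightarrow> 'a" where
  "second_fundamental_form S g M p v w =
     (THE b. \<exists>X Y. vector_field S X \<and> vector_field S Y \<and>
        (\<forall>q\<in>M. X q \<in> tangent_space M q \<and> Y q \<in> tangent_space M q) \<and>
        X p = v \<and> Y p = w \<and>
        b = normal_component S g M p (levi_civita S g X Y p))"

definition orthonormal_basis_of :: "('a::euclidean_space \<Rightarrow> 'a \<Rightarrow> real) \<Rightarrow> 'a set \<Rightarrow> 'a set \<Rightarrow> bool" where
  "orthonormal_basis_of h T E \<longleftrightarrow>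
     finite E \<and> span E = T \<and> (\<forall>u\<in>E. \<forall>v\<in>E. h u v = (if u = v then 1 else 0))"

text \<open>The trace of the second fundamental form, computed in any orthonormal basis.\<close>

definition mean_curvature ::
  "'a::euclidean_space set \<Rightarrow> ('a \<Rightarrow> 'a \<Rightarrow> 'a \<Rightarrow> real) \<Rightarrow> 'a set \<Rightarrow> 'a \<Rightarrow> 'a" where
  "mean_curvature S g M p =
     (THE h. \<exists>E. orthonormal_basis_of (g p) (tangent_space M p) E \<and>
                 h = (\<Sum>v\<in>E. second_fundamental_form S g M p v v))"

definition minimal_in ::
  "'a::euclidean_space set \<Rightarrow> ('a \<Rightarrow> 'a \<Rightarrow> 'a \<Rightarrow> real) \<Rightarrow> 'a set \<Rightarrow> bool" where
  "minimal_in S g M \<longleftrightarrow> (\<forall>p\<in>M. mean_curvature S g M p = 0)"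


section \<open>The special unitary group\<close>

definition conjugate_transpose :: "complex^'n^'m \<Rightarrow> complex^'m^'n" where
  "conjugate_transpose A = (\<chi> i j. cnj (A $ j $ i))"

definition special_unitary :: "(complex^'n^'n) set" where
  "special_unitary = {z. z ** conjugate_transpose z = mat 1 \<and> det z = 1}"

text \<open>
  The left translate to \<open>z\<close> of the inner product \<open>trace (X Y\<^sup>*)\<close>, which is real on skew-Hermitian
  matrices. It is bi-invariant because that inner product is invariant under conjugation by
  unitary matrices.
\<close>

definition special_unitary_metric ::
  "complex^'n^'n \<Rightarrow> complex^'n^'n \<Rightarrow> complex^'n^'n \<Rightarrow> real" where
  "special_unitary_metric z V W =
     Re (trace ((matrix_inv z ** V) ** conjugate_transpose (matrix_inv z ** W)))"

definition eigenvalues :: "complex^'n^'n \<Rightarrow> complex set" where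
  "eigenvalues H = {c. \<exists>v. v \<noteq> 0 \<and> H *v v = c *s v}"

definition conjugate_vector :: "complex^'n \<Rightarrow> complex^'n" where
  "conjugate_vector v = (\<chi> i. cnj (v $ i))"

text \<open>\<open>bilinear_value v H w\<close> is the scalar \<open>v\<^sup>t H w\<close>, without conjugation.\<close>

definition bilinear_value :: "complex^'n \<Rightarrow> complex^'n^'n \<Rightarrow> complex^'n \<Rightarrow> complex" where
  "bilinear_value v H w = (\<Sum>i\<in>UNIV. v $ i * (H *v w) $ i)"

end

theory Submission
  imports Defs
begin

text \<open>
  Put \<open>K\<close> for the entrywise conjugate of \<open>H\<close>, \<open>a\<close> and \<open>b\<close> for the indices of the first two columns, and
  \<open>B = z\<^sup>* K z\<close>. Up to conjugation the defining equation of \<open>M\<close> says that the entry \<open>B\<^sub>a\<^sub>b\<close> vanishes. Write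
  \<open>F z\<close> for this entry. On a tangent vector \<open>z Y\<close>, with \<open>Y\<close> in the Lie algebra, the derivative of \<open>F\<close>
  is \<open>[B, Y]\<^sub>a\<^sub>b = tr (P\<^sup>* Y)\<close> with \<open>P = [B\<^sup>*, E\<^sub>a\<^sub>b]\<close> (\<open>trace_ct_grad_mat\<close>).

  Submanifold. If \<open>P = 0\<close> at a zero of \<open>F\<close>, then the column \<open>z\<^sub>b\<close> is an eigenvector of \<open>K\<close> and \<open>z\<^sub>a\<^sup>*\<close> is
  a left eigenvector for the same eigenvalue, and the two are orthogonal. For a simple spectrum this is
  impossible, since \<open>z\<^sub>a\<close> would then be orthogonal to a basis of eigenvectors
  (\<open>orthogonal_eigenvectors_simple_spectrum\<close>). So \<open>P \<noteq> 0\<close> on \<open>M\<close>, and as the derivative is the real linear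
  restriction of a nonzero complex linear form in which \<open>tr (P\<^sup>* P\<^sup>*) = 0\<close>, it is onto \<open>\<complex>\<close>. Thus \<open>M\<close> is a
  regular level set in a Euclidean space, like \<open>SU(n)\<close> itself, and both are submanifolds with tangent
  spaces the kernels of the derivatives (\<open>level_set_chart\<close>, which rests on the inverse function theorem
  and on the smoothness of the inverse map).

  Minimality. The bi-invariant metric is the one induced by the Euclidean inner product of matrices, so
  the Levi-Civita connection is the tangential part of the ordinary derivative (\<open>levi_civita_eq\<close>).
  Differentiating \<open>F\<close> twice shows that the second fundamental form \<open>b(v, v)\<close>, for \<open>v = z Y\<close>, is the normal vector
  with \<open>dF (b(v, v)) = - [[B, Y], Y]\<^sub>a\<^sub>b\<close> (\<open>hessian_zero_set\<close>). Therefore the mean curvature vanishes if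
  the trace of \<open>Y \<mapsto> [[B, Y], Y]\<^sub>a\<^sub>b\<close> over the horizontal space \<open>{Y. tr (P\<^sup>* Y) = 0}\<close> is zero. The trace over all of
  \<open>su(n)\<close> is the entry \<open>a, b\<close> of a Casimir operator applied to \<open>B\<close>, hence a multiple of \<open>B\<^sub>a\<^sub>b = 0\<close>; the two normal directions
  \<open>P - P\<^sup>*\<close> and \<open>\<i> (P + P\<^sup>*)\<close> are orthogonal and equally long, and their contributions cancel
  (\<open>double_comm_normal_mats\<close>). What remains is the horizontal trace (\<open>sum_double_comm_orthonormal\<close>).
\<close>

section \<open>Calculus of \<open>C^k\<close> maps\<close>

lemma Ck_on_cong:
  assumes "open U" "\<And>x. x \<in> U \<Longrightarrow> f x = g x"
  shows "Ck_on k U f \<longleftrightarrow> Ck_on k U g"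
  using assms(2)
proof (induction k arbitrary: f g)
  case 0
  then show ?case by (simp cong: continuous_on_cong)
next
  case (Suc k)
  have trans: "g' differentiable (at x)"
    if x: "x \<in> U" and f': "f' differentiable (at x)" and eq: "\<And>x. x \<in> U \<Longrightarrow> f' x = g' x" for x f' and g' :: "'a \<Rightarrow> 'b"
  proof -
    obtain D where "(f' has_derivative D) (at x)" using f' unfolding differentiable_def by blast
    from has_derivative_transform_within_open[OF this assms(1) x eq]
    show ?thesis unfolding differentiable_def by blast
  qed
  have diff: "f differentiable (at x) \<longleftrightarrow> g differentiable (at x)" if "x \<in> U" for x
    using trans[OF that, of f g] trans[OF that, of g f] Suc.prems by force
  have der: "frechet_derivative f (at x) = frechet_derivative g (at x)"
    if "x \<in> U" "f differentiable (at x)" for x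
    by (rule frechet_derivative_transform_within_open[OF that(2) assms(1) that(1)]) (rule Suc.prems)
  have "Ck_on k U (\<lambda>x. frechet_derivative f (at x) v) \<longleftrightarrow>
      Ck_on k U (\<lambda>x. frechet_derivative g (at x) v)" if "\<forall>x\<in>U. f differentiable (at x)" for v
    by (rule Suc.IH) (simp add: der that)
  then show ?case unfolding Ck_on.simps using diff by blast
qed

lemma Ck_on_SucI:
  assumes "open U" "\<And>x. x \<in> U \<Longrightarrow> (f has_derivative f' x) (at x)"
    and "\<And>v. Ck_on k U (\<lambda>x. f' x v)"
  shows "Ck_on (Suc k) U f"
proof -
  have "frechet_derivative f (at x) = f' x" if "x \<in> U" for x
    by (rule frechet_derivative_at[OF assms(2)[OF that], symmetric])
  then have "Ck_on k U (\<lambda>x. frechet_derivative f (at x) v)" for v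
    using Ck_on_cong[OF assms(1), of "\<lambda>x. frechet_derivative f (at x) v" "\<lambda>x. f' x v"] assms(3)
    by simp
  then show ?thesis using assms(2) unfolding Ck_on.simps differentiable_def by blast
qed

lemma Ck_on_SucD:
  assumes "Ck_on (Suc k) U f"
  shows "x \<in> U \<Longrightarrow> (f has_derivative frechet_derivative f (at x)) (at x)"
    and "Ck_on k U (\<lambda>x. frechet_derivative f (at x) v)"
  using assms frechet_derivative_works unfolding Ck_on.simps by blast+

lemma Ck_on_Suc_imp: "Ck_on (Suc k) U f \<Longrightarrow> Ck_on k U f"
proof (induction k arbitrary: f)
  case 0
  then show ?case
    by (auto intro!: continuous_at_imp_continuous_on differentiable_imp_continuous_within)
next
  case (Suc k)
  then show ?case by auto
qed

lemma Ck_on_imp_continuous_on: "Ck_on k U f \<Longrightarrow> continuous_on U f"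
proof (induction k)
  case (Suc k)
  then show ?case using Ck_on_Suc_imp by blast
qed simp

lemma Ck_on_subset: "Ck_on k U f \<Longrightarrow> V \<subseteq> U \<Longrightarrow> Ck_on k V f"
proof (induction k arbitrary: f)
  case 0
  then show ?case by (simp add: continuous_on_subset)
next
  case (Suc k)
  then show ?case unfolding Ck_on.simps by blast
qed

lemma Ck_on_const: "open U \<Longrightarrow> Ck_on k U (\<lambda>x. c)"
proof (induction k arbitrary: c)
  case (Suc k)
  then show ?case by (intro Ck_on_SucI[where f'="\<lambda>x v. 0"]) auto
qed simp

lemma Ck_on_linear:
  assumes "open U" "bounded_linear f"
  shows "Ck_on k U f"
proof (cases k)
  case 0
  then show ?thesis using assms by (simp add: linear_continuous_on)
next
  case (Suc k')
  then show ?thesis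
    using Ck_on_SucI[of U f "\<lambda>x. f" k'] bounded_linear.has_derivative[OF assms(2) has_derivative_ident]
      Ck_on_const[OF assms(1)] assms(1) by auto
qed

lemma Ck_on_add:
  assumes "open U"
  shows "Ck_on k U f \<Longrightarrow> Ck_on k U g \<Longrightarrow> Ck_on k U (\<lambda>x. f x + g x)"
proof (induction k arbitrary: f g)
  case 0
  then show ?case by (simp add: continuous_on_add)
next
  case (Suc k)
  show ?case
    by (rule Ck_on_SucI[OF assms has_derivative_add[OF Ck_on_SucD(1)[OF Suc.prems(1)] Ck_on_SucD(1)[OF Suc.prems(2)]]])
       (auto intro!: Suc.IH Ck_on_SucD(2) Suc.prems)
qed

lemma Ck_on_bilinear:
  fixes prod :: "'b::euclidean_space \<Rightarrow> 'c::euclidean_space \<Rightarrow> 'd::euclidean_space"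
  assumes "open U" "bounded_bilinear prod"
  shows "Ck_on k U f \<Longrightarrow> Ck_on k U g \<Longrightarrow> Ck_on k U (\<lambda>x. prod (f x) (g x))"
proof (induction k arbitrary: f g)
  case 0
  then show ?case using bounded_bilinear.continuous_on[OF assms(2)] by simp
next
  case (Suc k)
  show ?case
    by (rule Ck_on_SucI[OF assms(1) bounded_bilinear.FDERIV[OF assms(2) Ck_on_SucD(1)[OF Suc.prems(1)] Ck_on_SucD(1)[OF Suc.prems(2)]]])
       (assumption | intro Ck_on_add[OF assms(1)] Suc.IH Ck_on_Suc_imp[OF Suc.prems(1)] Ck_on_Suc_imp[OF Suc.prems(2)]
          Ck_on_SucD(2)[OF Suc.prems(1)] Ck_on_SucD(2)[OF Suc.prems(2)])+
qed

lemma Ck_on_sum: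
  assumes "open U" "\<And>i. i \<in> I \<Longrightarrow> Ck_on k U (f i)"
  shows "Ck_on k U (\<lambda>x. \<Sum>i\<in>I. f i x)"
  using assms(2)
proof (induction I rule: infinite_finite_induct)
  case (insert i I)
  then show ?case using Ck_on_add[OF assms(1), of k "f i" "\<lambda>x. \<Sum>i\<in>I. f i x"] by simp
qed (auto intro: Ck_on_const[OF assms(1)])

lemma Ck_on_mult:
  fixes f g :: "'a::euclidean_space \<Rightarrow> 'b::{euclidean_space, real_normed_algebra}"
  assumes "open U" "Ck_on k U f" "Ck_on k U g"
  shows "Ck_on k U (\<lambda>x. f x * g x)"
  using Ck_on_bilinear[OF assms(1) bounded_bilinear_mult assms(2,3)] .

lemma Ck_on_prod:
  fixes f :: "'i \<Rightarrow> 'a::euclidean_space \<Rightarrow> 'b::{euclidean_space, real_normed_field}"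
  assumes "open U" "\<And>i. i \<in> I \<Longrightarrow> Ck_on k U (f i)"
  shows "Ck_on k U (\<lambda>x. \<Prod>i\<in>I. f i x)"
  using assms(2)
proof (induction I rule: infinite_finite_induct)
  case (insert i I)
  then show ?case using Ck_on_mult[OF assms(1), of k "f i" "\<lambda>x. \<Prod>i\<in>I. f i x"] by simp
qed (auto intro: Ck_on_const[OF assms(1)])

lemma Ck_on_linear_compose:
  assumes "open U" "bounded_linear l"
  shows "Ck_on k U f \<Longrightarrow> Ck_on k U (\<lambda>x. l (f x))"
proof (induction k arbitrary: f)
  case 0
  then show ?case using bounded_linear.continuous_on[OF assms(2)] by simp
next
  case (Suc k)
  show ?case
    by (rule Ck_on_SucI[OF assms(1) bounded_linear.has_derivative[OF assms(2) Ck_on_SucD(1)[OF Suc.prems]]])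
       (auto intro!: Suc.IH Ck_on_SucD(2) Suc.prems)
qed

lemma linear_expand_Basis:
  fixes L :: "'a::euclidean_space \<Rightarrow> 'b::real_vector"
  assumes "linear L"
  shows "L v = (\<Sum>b\<in>Basis. (v \<bullet> b) *\<^sub>R L b)"
proof -
  have "L v = L (\<Sum>b\<in>Basis. (v \<bullet> b) *\<^sub>R b)" by (simp add: euclidean_representation)
  then show ?thesis by (simp add: linear_sum[OF assms] linear_scale[OF assms])
qed

text \<open>
  \<open>Ck_on\<close> controls derivatives in fixed directions. A derivative in a direction \<open>w x\<close> that varies with
  the point, as the chain rule produces it, is therefore expanded in a basis.
\<close>

lemma Ck_on_apply_linear:
  fixes T :: "'a::euclidean_space \<Rightarrow> 'b::euclidean_space \<Rightarrow> 'c::euclidean_space"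
  assumes "open U" "\<And>x. x \<in> U \<Longrightarrow> linear (T x)" "\<And>v. Ck_on k U (\<lambda>x. T x v)" "Ck_on k U w"
  shows "Ck_on k U (\<lambda>x. T x (w x))"
proof -
  have "Ck_on k U (\<lambda>x. \<Sum>b\<in>Basis. (w x \<bullet> b) *\<^sub>R T x b)"
    by (intro Ck_on_sum Ck_on_bilinear[OF assms(1) bounded_bilinear_scaleR] assms
        Ck_on_linear_compose[OF assms(1) bounded_linear_inner_left])
  then show ?thesis
    using Ck_on_cong[OF assms(1), of "\<lambda>x. T x (w x)" "\<lambda>x. \<Sum>b\<in>Basis. (w x \<bullet> b) *\<^sub>R T x b"]
      linear_expand_Basis[OF assms(2)] by blast
qed

lemma Ck_on_compose:
  fixes f :: "'a::euclidean_space \<Rightarrow> 'b::euclidean_space" and g :: "'b \<Rightarrow> 'c::euclidean_space"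
  assumes "open U" "open V" "f ` U \<subseteq> V"
  shows "Ck_on k U f \<Longrightarrow> Ck_on k V g \<Longrightarrow> Ck_on k U (\<lambda>x. g (f x))"
proof (induction k arbitrary: g)
  case 0
  then show ?case using assms(3) by (auto intro: continuous_on_compose2)
next
  case (Suc k)
  have df: "(f has_derivative frechet_derivative f (at x)) (at x)" if "x \<in> U" for x
    using Ck_on_SucD(1)[OF Suc.prems(1) that] .
  have dg: "(g has_derivative frechet_derivative g (at (f x))) (at (f x))" if "x \<in> U" for x
    using Ck_on_SucD(1)[OF Suc.prems(2)] that assms(3) by blast
  show ?case
  proof (rule Ck_on_SucI[OF assms(1)])
    show "((\<lambda>x. g (f x)) has_derivative
        (\<lambda>v. frechet_derivative g (at (f x)) (frechet_derivative f (at x) v))) (at x)" if "x \<in> U" for x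
      using has_derivative_compose[OF df[OF that] dg[OF that]] .
    show "Ck_on k U (\<lambda>x. frechet_derivative g (at (f x)) (frechet_derivative f (at x) v))" for v
    proof (rule Ck_on_apply_linear[OF assms(1), where T = "\<lambda>x. frechet_derivative g (at (f x))"])
      show "linear (frechet_derivative g (at (f x)))" if "x \<in> U" for x
        using dg[OF that] has_derivative_linear by blast
      show "Ck_on k U (\<lambda>x. frechet_derivative g (at (f x)) w)" for w
        using Suc.IH[OF Ck_on_Suc_imp[OF Suc.prems(1)] Ck_on_SucD(2)[OF Suc.prems(2)]] .
      show "Ck_on k U (\<lambda>x. frechet_derivative f (at x) v)"
        using Ck_on_SucD(2)[OF Suc.prems(1)] .
    qed
  qed
qed

text \<open>
  At a zero of \<open>f\<close> the product rule asks only for continuity of \<open>g\<close>. The inverse of a family of operators is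
  known to be continuous before it is known to be differentiable; this lemma leads from the one to the other.
\<close>

lemma has_derivative_scaleR_vanishing:
  fixes f :: "'a::real_normed_vector \<Rightarrow> real" and g :: "'a \<Rightarrow> 'b::real_normed_vector"
  assumes f: "(f has_derivative f') (at x)" and f0: "f x = 0" and g: "isCont g x"
  shows "((\<lambda>y. f y *\<^sub>R g y) has_derivative (\<lambda>v. f' v *\<^sub>R g x)) (at x)"
proof -
  have 1: "((\<lambda>y. f y *\<^sub>R g x) has_derivative (\<lambda>v. f' v *\<^sub>R g x)) (at x)"
    using has_derivative_scaleR_left[OF f] .
  have bl: "bounded_linear f'" using f has_derivative_bounded_linear by blast
  obtain K where K: "K > 0" "\<And>v. norm (f' v) \<le> norm v * K"
    using bounded_linear.pos_bounded[OF bl] by blast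
  have rem: "((\<lambda>y. norm (f y - f x - f' (y - x)) / norm (y - x)) \<longlongrightarrow> 0) (at x)"
    using f unfolding has_derivative_iff_norm by blast
  have "((\<lambda>y. f y *\<^sub>R (g y - g x)) has_derivative (\<lambda>v. 0)) (at x)"
    unfolding has_derivative_iff_norm
  proof (intro conjI bounded_linear_zero)
    have "((\<lambda>y. (norm (f y - f x - f' (y - x)) / norm (y - x) + K) * norm (g y - g x)) \<longlongrightarrow> (0 + K) * 0) (at x)"
      using g by (intro tendsto_mult tendsto_add rem tendsto_const)
         (simp add: isCont_def LIM_zero tendsto_norm_zero)
    then have lim: "((\<lambda>y. (norm (f y - f x - f' (y - x)) / norm (y - x) + K) * norm (g y - g x)) \<longlongrightarrow> 0) (at x)" by simp
    have "norm (norm (f y *\<^sub>R (g y - g x) - f x *\<^sub>R (g x - g x) - 0) / norm (y - x)) \<le>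
        (norm (f y - f x - f' (y - x)) / norm (y - x) + K) * norm (g y - g x)" if "y \<noteq> x" for y
    proof -
      have "norm (f y) \<le> norm (f y - f x - f' (y - x)) + norm (f' (y - x))"
        using f0 norm_triangle_ineq[of "f y - f' (y - x)" "f' (y - x)"] by simp
      also have "\<dots> \<le> norm (f y - f x - f' (y - x)) + norm (y - x) * K"
        using K by simp
      finally have "norm (f y) / norm (y - x) \<le> norm (f y - f x - f' (y - x)) / norm (y - x) + K"
        using that by (simp add: field_simps)
      then have "norm (f y) / norm (y - x) * norm (g y - g x) \<le>
          (norm (f y - f x - f' (y - x)) / norm (y - x) + K) * norm (g y - g x)"
        by (intro mult_right_mono) auto
      then show ?thesis using f0 by simp
    qed
    then have "eventually (\<lambda>y. norm (norm (f y *\<^sub>R (g y - g x) - f x *\<^sub>R (g x - g x) - 0) / norm (y - x)) \<le>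
        (norm (f y - f x - f' (y - x)) / norm (y - x) + K) * norm (g y - g x)) (at x)"
      by (auto simp: eventually_at_filter)
    then show "((\<lambda>y. norm (f y *\<^sub>R (g y - g x) - f x *\<^sub>R (g x - g x) - 0) / norm (y - x)) \<longlongrightarrow> 0) (at x)"
      by (rule Lim_null_comparison[OF _ lim])
  qed
  from has_derivative_add[OF 1 this] show ?thesis by (simp add: algebra_simps)
qed

text \<open>
  The difference of inverses is \<open>S x v - S x0 v = S x ((T x0 - T x) (S x0 v))\<close>, so it suffices to bound
  \<open>S x\<close> near \<open>x0\<close>. With \<open>w = S x z\<close> the bound comes from
  \<open>norm w \<le> K * norm (T x0 w) \<le> K * (norm z + norm (T x w - T x0 w))\<close>, in which the last term is
  absorbed by the left-hand side once \<open>T x\<close> is close to \<open>T x0\<close>.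
\<close>

lemma isCont_inverse_family:
  fixes T S :: "'a::t2_space \<Rightarrow> 'b::euclidean_space \<Rightarrow> 'b"
  assumes U: "open U" "x0 \<in> U" and lin: "\<And>x. x \<in> U \<Longrightarrow> linear (T x)" "\<And>x. x \<in> U \<Longrightarrow> linear (S x)"
    and TS: "\<And>x v. x \<in> U \<Longrightarrow> T x (S x v) = v" and ST: "\<And>x v. x \<in> U \<Longrightarrow> S x (T x v) = v"
    and cont: "\<And>v. isCont (\<lambda>x. T x v) x0"
  shows "isCont (\<lambda>x. S x v) x0"
proof -
  define E where "E x = (\<Sum>b\<in>Basis. norm (T x b - T x0 b))" for x
  have E: "(E \<longlongrightarrow> 0) (at x0)"
    unfolding E_def using cont by (intro tendsto_null_sum tendsto_norm_zero) (simp add: isCont_def LIM_zero)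
  have TE: "norm (T x w - T x0 w) \<le> E x * norm w" if "x \<in> U" for x w
  proof -
    have l: "linear (\<lambda>w. T x w - T x0 w)" using lin(1) that U(2) by (intro linear_compose_sub) auto
    have "norm (T x w - T x0 w) = norm (\<Sum>b\<in>Basis. (w \<bullet> b) *\<^sub>R (T x b - T x0 b))"
      using linear_expand_Basis[OF l] by metis
    also have "\<dots> \<le> (\<Sum>b\<in>Basis. norm w * norm (T x b - T x0 b))"
      by (rule sum_norm_le) (simp add: mult_right_mono Basis_le_norm)
    also have "\<dots> = E x * norm w" by (simp add: E_def sum_distrib_left mult.commute)
    finally show ?thesis .
  qed
  have bl: "bounded_linear (S x0)" using lin(2)[OF U(2)] linear_conv_bounded_linear by blast
  obtain K where K: "K > 0" "\<And>v. norm (S x0 v) \<le> norm v * K"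
    using bounded_linear.pos_bounded[OF bl] by blast
  have small: "eventually (\<lambda>x. E x < 1 / (2 * K)) (at x0)"
    using E K by (intro order_tendstoD) auto
  have inU: "eventually (\<lambda>x. x \<in> U) (at x0)" using U by (auto simp: eventually_at_topological)
  have bnd: "norm (S x z) \<le> 2 * K * norm z" if "x \<in> U" "E x < 1 / (2 * K)" for x z
  proof -
    define w where "w = S x z"
    have Tw: "T x w = z" using TS that w_def by simp
    have "norm w = norm (S x0 (T x0 w))" using ST U by simp
    also have "\<dots> \<le> norm (T x0 w) * K" using K by blast
    also have "\<dots> \<le> (norm z + E x * norm w) * K"
    proof -
      have "norm (T x0 w) \<le> norm (T x w) + norm (T x w - T x0 w)"
        by (metis norm_minus_commute norm_triangle_sub)
      then show ?thesis using TE[OF that(1), of w] Tw K by (intro mult_right_mono) auto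
    qed
    also have "\<dots> = norm z * K + E x * K * norm w" by (simp add: algebra_simps)
    also have "\<dots> \<le> norm z * K + 1/2 * norm w"
    proof -
      have "E x * K \<le> 1/2" using that(2) K by (simp add: field_simps)
      then show ?thesis by (intro add_left_mono mult_right_mono) auto
    qed
    finally show ?thesis unfolding w_def by (simp add: algebra_simps)
  qed
  have "((\<lambda>x. S x v - S x0 v) \<longlongrightarrow> 0) (at x0)"
  proof (rule Lim_null_comparison)
    show "((\<lambda>x. 2 * K * norm (T x (S x0 v) - T x0 (S x0 v))) \<longlongrightarrow> 0) (at x0)"
      using cont[of "S x0 v"]
      by (intro tendsto_mult_right_zero tendsto_norm_zero) (simp add: isCont_def LIM_zero)
    show "eventually (\<lambda>x. norm (S x v - S x0 v) \<le> 2 * K * norm (T x (S x0 v) - T x0 (S x0 v))) (at x0)"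
      using small inU
    proof eventually_elim
      case (elim x)
      have "S x v - S x0 v = S x (T x0 (S x0 v) - T x (S x0 v))"
        using TS[OF U(2)] ST[OF elim(2)] linear_diff[OF lin(2)[OF elim(2)]] by simp
      then show ?case using bnd[OF elim(2,1), of "T x0 (S x0 v) - T x (S x0 v)"]
        by (simp add: norm_minus_commute)
    qed
  qed
  then show ?thesis by (simp add: isCont_def LIM_zero_iff)
qed

text \<open>
  Induction on \<open>k\<close>: the derivative of \<open>S\<close> is \<open>- S \<circ> T' \<circ> S\<close>, and this is of class \<open>C^k\<close> when \<open>S\<close>
  and \<open>T'\<close> are.
\<close>

lemma Ck_on_inverse_family:
  fixes T S :: "'a::euclidean_space \<Rightarrow> 'b::euclidean_space \<Rightarrow> 'b"
  assumes U: "open U" and lin: "\<And>x. x \<in> U \<Longrightarrow> linear (T x)" "\<And>x. x \<in> U \<Longrightarrow> linear (S x)"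
    and TS: "\<And>x v. x \<in> U \<Longrightarrow> T x (S x v) = v" and ST: "\<And>x v. x \<in> U \<Longrightarrow> S x (T x v) = v"
  shows "(\<And>v. Ck_on k U (\<lambda>x. T x v)) \<Longrightarrow> Ck_on k U (\<lambda>x. S x v)"
proof (induction k arbitrary: v)
  case 0
  then show ?case
    using isCont_inverse_family[OF U _ lin TS ST]
    by (auto simp: continuous_on_eq_continuous_at[OF U])
next
  case (Suc k)
  have contT: "isCont (\<lambda>x. T x w) x" if "x \<in> U" for x w
    using Ck_on_imp_continuous_on[OF Suc.prems] that continuous_on_eq_continuous_at[OF U] by blast
  have contS: "isCont (\<lambda>x. S x w) x" if "x \<in> U" for x w
    using isCont_inverse_family[OF U that lin TS ST contT[OF that]] .
  define T' where "T' x w = frechet_derivative (\<lambda>x. T x w) (at x)" for x w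
  have dT: "((\<lambda>x. T x w) has_derivative T' x w) (at x)" if "x \<in> U" for x w
    using Ck_on_SucD(1)[OF Suc.prems that] unfolding T'_def .
  have CkT': "Ck_on k U (\<lambda>x. T' x w u)" for w u
    using Ck_on_SucD(2)[OF Suc.prems] unfolding T'_def .
  have dS: "((\<lambda>x. S x v) has_derivative (\<lambda>u. - S x (T' x (S x v) u))) (at x)" if x: "x \<in> U" for x
  proof -
    define w where "w = S x v"
    have "((\<lambda>y. w - (\<Sum>b\<in>Basis. ((T y w - T x w) \<bullet> b) *\<^sub>R S y b)) has_derivative
        (\<lambda>u. 0 - (\<Sum>b\<in>Basis. (T' x w u \<bullet> b) *\<^sub>R S x b))) (at x)"
    proof (intro has_derivative_diff has_derivative_const has_derivative_sum
        has_derivative_scaleR_vanishing contS[OF x])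
      show "((\<lambda>y. (T y w - T x w) \<bullet> b) has_derivative (\<lambda>u. T' x w u \<bullet> b)) (at x)" for b
        using has_derivative_inner_left[OF has_derivative_diff[OF dT[OF x, of w] has_derivative_const]] by simp
    qed simp
    then have "((\<lambda>y. w - (\<Sum>b\<in>Basis. ((T y w - T x w) \<bullet> b) *\<^sub>R S y b)) has_derivative
        (\<lambda>u. - S x (T' x w u))) (at x)"
      by (simp add: linear_expand_Basis[OF lin(2)[OF x], symmetric])
    then show ?thesis unfolding w_def[symmetric]
    proof (rule has_derivative_transform_within_open[OF _ U x])
      fix y assume y: "y \<in> U"
      have "(\<Sum>b\<in>Basis. ((T y w - T x w) \<bullet> b) *\<^sub>R S y b) = S y (T y w - T x w)"
        using linear_expand_Basis[OF lin(2)[OF y]] by metis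
      also have "\<dots> = w - S y v"
        using ST[OF y] TS[OF x] linear_diff[OF lin(2)[OF y]] by (simp add: w_def)
      finally show "w - (\<Sum>b\<in>Basis. ((T y w - T x w) \<bullet> b) *\<^sub>R S y b) = S y v" by simp
    qed
  qed
  have Sk: "Ck_on k U (\<lambda>x. S x w)" for w
    using Suc.IH Ck_on_Suc_imp[OF Suc.prems] by blast
  have linT': "linear (\<lambda>w. T' x w u)" if x: "x \<in> U" for x u
  proof
    show "T' x (w1 + w2) u = T' x w1 u + T' x w2 u" for w1 w2
    proof -
      have "((\<lambda>y. T y w1 + T y w2) has_derivative T' x (w1 + w2)) (at x)"
        by (rule has_derivative_transform_within_open[OF dT[OF x] U x]) (simp add: linear_add[OF lin(1)])
      then show ?thesis using has_derivative_unique[OF _ has_derivative_add[OF dT[OF x, of w1] dT[OF x, of w2]]]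
        by metis
    qed
    show "T' x (c *\<^sub>R w1) u = c *\<^sub>R T' x w1 u" for c w1
    proof -
      have "((\<lambda>y. c *\<^sub>R T y w1) has_derivative T' x (c *\<^sub>R w1)) (at x)"
        by (rule has_derivative_transform_within_open[OF dT[OF x] U x]) (simp add: linear_scale[OF lin(1)])
      then show ?thesis using has_derivative_unique[OF _ has_derivative_scaleR_right[OF dT[OF x, of w1]]]
        by metis
    qed
  qed
  show ?case
  proof (rule Ck_on_SucI[OF U dS])
    fix u
    have 1: "Ck_on k U (\<lambda>x. T' x (S x v) u)"
      by (rule Ck_on_apply_linear[OF U linT' CkT' Sk])
    have "Ck_on k U (\<lambda>x. S x (T' x (S x v) u))"
      by (rule Ck_on_apply_linear[OF U lin(2) Sk 1])
    then show "Ck_on k U (\<lambda>x. - S x (T' x (S x v) u))"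
      by (rule Ck_on_linear_compose[OF U bounded_linear_minus[OF bounded_linear_ident]])
  qed
qed

lemma smooth_on_openI: "open U \<Longrightarrow> (\<And>k. Ck_on k U f) \<Longrightarrow> smooth_on_open U f"
  unfolding smooth_on_open_def by blast

lemma smooth_on_openD:
  assumes "smooth_on_open U f"
  shows "open U" "Ck_on k U f" "x \<in> U \<Longrightarrow> (f has_derivative frechet_derivative f (at x)) (at x)"
    "smooth_on_open U (\<lambda>x. frechet_derivative f (at x) v)"
proof -
  have C: "open U" "\<And>k. Ck_on k U f" using assms by (auto simp: smooth_on_open_def)
  show "open U" "Ck_on k U f" using C by auto
  show "x \<in> U \<Longrightarrow> (f has_derivative frechet_derivative f (at x)) (at x)"
    using Ck_on_SucD(1)[OF C(2)] .
  show "smooth_on_open U (\<lambda>x. frechet_derivative f (at x) v)"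
    using Ck_on_SucD(2)[OF C(2)] C(1) by (simp add: smooth_on_open_def)
qed

text \<open>
  The derivative of \<open>g\<close> at \<open>y\<close> is the inverse of that of \<open>f\<close> at \<open>g y\<close>. So each class of differentiability of \<open>g\<close>
  is inherited by its derivative, and \<open>g\<close> gains one class.
\<close>

lemma smooth_on_open_inverse:
  fixes f :: "'a::euclidean_space \<Rightarrow> 'a"
  assumes f: "smooth_on_open U f" and V: "open V" "g ` V \<subseteq> U"
    and g: "\<And>y. y \<in> V \<Longrightarrow> (g has_derivative g' y) (at y)"
    and inv: "\<And>y v. y \<in> V \<Longrightarrow> frechet_derivative f (at (g y)) (g' y v) = v"
      "\<And>y v. y \<in> V \<Longrightarrow> g' y (frechet_derivative f (at (g y)) v) = v"
  shows "smooth_on_open V g"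
proof (rule smooth_on_openI[OF V(1)])
  fix k show "Ck_on k V g"
  proof (induction k)
    case 0
    show ?case using g by (auto intro!: continuous_at_imp_continuous_on has_derivative_continuous)
  next
    case (Suc k)
    show ?case
    proof (rule Ck_on_SucI[OF V(1) g])
      fix v
      show "Ck_on k V (\<lambda>y. g' y v)"
      proof (rule Ck_on_inverse_family[OF V(1), where T = "\<lambda>y. frechet_derivative f (at (g y))"])
        show "linear (frechet_derivative f (at (g y)))" if "y \<in> V" for y
          using smooth_on_openD(3)[OF f] V(2) that has_derivative_linear by blast
        show "linear (g' y)" if "y \<in> V" for y using g[OF that] has_derivative_linear by blast
        show "Ck_on k V (\<lambda>y. frechet_derivative f (at (g y)) w)" for w
          by (rule Ck_on_compose[OF V(1) smooth_on_openD(1)[OF f] V(2) Suc smooth_on_openD(2)[OF smooth_on_openD(4)[OF f]]])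
      qed (use inv in auto)
    qed
  qed
qed

section \<open>Level sets of smooth maps\<close>

lemma subspace_projection:
  fixes W :: "'a::euclidean_space set"
  assumes "subspace W"
  obtains g where "linear g" "range g \<subseteq> W" "\<And>w. w \<in> W \<Longrightarrow> g w = w"
proof -
  obtain g where "range g \<subseteq> W" "linear g" "\<forall>v\<in>(\<lambda>x. x) ` W. g v = v"
    using linear_exists_right_inverse_on[OF linear_ident assms] by blast
  then show thesis using that[of g] by simp
qed

text \<open>
  A linear projection onto \<open>W\<close> fixes \<open>f\<close>, hence it also fixes the derivative of \<open>f\<close>.
\<close>

lemma has_vector_derivative_in_subspace:
  fixes f :: "real \<Rightarrow> 'a::euclidean_space"
  assumes W: "subspace W" and f: "(f has_vector_derivative d) (at t)" and fW: "\<And>s. f s \<in> W"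
  shows "d \<in> W"
proof -
  obtain g where g: "linear g" "range g \<subseteq> W" "\<And>w. w \<in> W \<Longrightarrow> g w = w"
    by (rule subspace_projection[OF W]) blast
  have "((\<lambda>s. g (f s)) has_vector_derivative g d) (at t)"
    using bounded_linear.has_vector_derivative[OF _ f] g(1) linear_conv_bounded_linear by blast
  then have "(f has_vector_derivative g d) (at t)" using g(3) fW by simp
  then have "d = g d" using vector_derivative_unique_at f by blast
  then show ?thesis using g(2) by auto
qed

lemma has_derivative_in_subspace:
  fixes f :: "'a::real_normed_vector \<Rightarrow> 'b::euclidean_space"
  assumes W: "subspace W" and f: "(f has_derivative D) (at x)" and U: "open U" "x \<in> U"
    and fW: "\<And>y. y \<in> U \<Longrightarrow> f y \<in> W"
  shows "D v \<in> W"
proof -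
  obtain g where g: "linear g" "range g \<subseteq> W" "\<And>w. w \<in> W \<Longrightarrow> g w = w"
    by (rule subspace_projection[OF W]) blast
  have "((\<lambda>y. g (f y)) has_derivative (\<lambda>v. g (D v))) (at x)"
    using bounded_linear.has_derivative[OF _ f] g(1) linear_conv_bounded_linear by blast
  then have "(f has_derivative (\<lambda>v. g (D v))) (at x)"
    by (rule has_derivative_transform_within_open[OF _ U]) (simp add: g(3) fW)
  then have "D = (\<lambda>v. g (D v))" by (rule has_derivative_unique[OF f])
  then have "D v = g (D v)" by metis
  then show ?thesis using g(2) by auto
qed

text \<open>
  \<open>D\<close> maps the orthogonal complement of its kernel bijectively onto its range.
\<close>

lemma dim_kernel_plus_dim_range:
  fixes D :: "'a::euclidean_space \<Rightarrow> 'b::euclidean_space"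
  assumes D: "linear D"
  shows "dim {v. D v = 0} + dim (range D) = DIM('a)"
proof -
  define K where "K = {v. D v = 0}"
  define C where "C = {y. \<forall>x\<in>K. orthogonal x y}"
  have K: "subspace K" unfolding K_def using linear_subspace_kernel[OF D] .
  have C: "subspace C" unfolding C_def orthogonal_def subspace_def by (auto simp: inner_add_right)
  have dimC: "dim C + dim K = DIM('a)"
    using dim_subspace_orthogonal_to_vectors[OF K subspace_UNIV] by (simp add: C_def)
  have inj: "inj_on D C"
  proof (rule inj_onI)
    fix x y assume xy: "x \<in> C" "y \<in> C" "D x = D y"
    then have "x - y \<in> K" "x - y \<in> C"
      using subspace_diff[OF C] linear_diff[OF D] by (auto simp: K_def)
    then have "orthogonal (x - y) (x - y)" unfolding C_def by blast
    then show "x = y" by (simp add: orthogonal_def)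
  qed
  have "range D = D ` C"
  proof (intro equalityI subsetI)
    fix w assume "w \<in> range D"
    then obtain x where x: "w = D x" by blast
    obtain y z where yz: "y \<in> span K" "\<And>v. v \<in> span K \<Longrightarrow> orthogonal z v" "x = y + z"
      using orthogonal_subspace_decomp_exists by blast
    have "z \<in> C" using yz(2) span_base by (auto simp: C_def orthogonal_commute)
    moreover have "D y = 0" using yz(1) K span_eq_iff[of K] unfolding K_def by blast
    ultimately show "w \<in> D ` C" using x yz(3) linear_add[OF D] by auto
  qed auto
  moreover have "dim (D ` C) = dim C"
    using dim_image_eq[OF D] inj span_eq_iff C by metis
  ultimately show ?thesis using dimC by (simp add: K_def)
qed

text \<open>
  Let \<open>R\<close> be a right inverse of \<open>D\<close> on \<open>W\<close>. The map \<open>\<phi> x = x + R (G x - D x)\<close> has derivative \<open>id\<close> at \<open>p\<close> and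
  satisfies \<open>D (\<phi> x) = G x\<close>. So it straightens the level set to the kernel of \<open>D\<close>, and it is a local
  diffeomorphism by the inverse function theorem. The equations may take their values in a subspace \<open>W\<close>
  because those of the unitary group are Hermitian matrices, not arbitrary ones.
\<close>

lemma level_set_chart:
  fixes G :: "'a::euclidean_space \<Rightarrow> 'b::euclidean_space"
  assumes G: "smooth_on_open \<Omega> G" and W: "subspace W" and GW: "\<And>x. x \<in> \<Omega> \<Longrightarrow> G x \<in> W"
    and p: "p \<in> \<Omega>" "G p = 0" and D: "(G has_derivative D) (at p)" and surj: "W \<subseteq> range D"
  obtains U V \<phi> \<psi> where "p \<in> U" "U \<subseteq> \<Omega>" "smooth_on_open U \<phi>" "smooth_on_open V \<psi>"
    "homeomorphism U V \<phi> \<psi>" "\<phi> ` (U \<inter> {x\<in>\<Omega>. G x = 0}) = V \<inter> {v. D v = 0}"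
    "(\<psi> has_derivative id) (at (\<phi> p))"
proof -
  have opn: "open \<Omega>" using smooth_on_openD(1)[OF G] .
  have linD: "linear D" using D has_derivative_linear by blast
  have DW: "D v \<in> W" for v by (rule has_derivative_in_subspace[OF W D opn p(1) GW])
  obtain R where R: "linear R" "\<And>w. w \<in> W \<Longrightarrow> D (R w) = w"
    using linear_exists_right_inverse_on[OF linD subspace_UNIV] surj by blast
  have blR: "bounded_linear R" and blD: "bounded_linear D"
    using R(1) linD linear_conv_bounded_linear by auto
  define \<phi> where "\<phi> x = x + R (G x - D x)" for x
  have smooth: "smooth_on_open \<Omega> \<phi>"
  proof (rule smooth_on_openI[OF opn])
    fix k
    have "Ck_on k \<Omega> (\<lambda>x. x + R (G x + - D x))"
      by (intro Ck_on_add[OF opn] Ck_on_linear_compose[OF opn blR] Ck_on_linear[OF opn]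
          smooth_on_openD(2)[OF G] bounded_linear_minus blD bounded_linear_ident)
    then show "Ck_on k \<Omega> \<phi>" by (simp add: \<phi>_def[abs_def])
  qed
  define \<phi>' where "\<phi>' x = Blinfun (frechet_derivative \<phi> (at x))" for x
  have ap: "blinfun_apply (\<phi>' x) = frechet_derivative \<phi> (at x)" if "x \<in> \<Omega>" for x
    unfolding \<phi>'_def using smooth_on_openD(3)[OF smooth that]
    by (intro bounded_linear_Blinfun_apply has_derivative_bounded_linear)
  have der: "(\<phi> has_derivative blinfun_apply (\<phi>' x)) (at x)" if "x \<in> \<Omega>" for x
    using smooth_on_openD(3)[OF smooth that] ap[OF that] by simp
  have cont: "continuous_on \<Omega> \<phi>'"
  proof (rule continuous_on_blinfun_componentwise)
    fix i
    have "continuous_on \<Omega> (\<lambda>x. frechet_derivative \<phi> (at x) i)"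
      using smooth_on_openD(2)[OF smooth_on_openD(4)[OF smooth], of 0] by simp
    then show "continuous_on \<Omega> (\<lambda>x. blinfun_apply (\<phi>' x) i)"
      by (rule continuous_on_cong[THEN iffD1, rotated 2]) (simp_all add: ap)
  qed
  have "(\<phi> has_derivative (\<lambda>v. v + R (D v - D v))) (at p)"
    unfolding \<phi>_def
    by (intro has_derivative_add has_derivative_ident bounded_linear.has_derivative[OF blR]
        has_derivative_diff D bounded_linear.has_derivative[OF blD])
  then have idp: "(\<phi> has_derivative id) (at p)"
    using linear_0[OF R(1)] by (simp add: id_def)
  have app: "blinfun_apply (\<phi>' p) = id"
    using has_derivative_unique[OF idp der[OF p(1)]] by simp
  have inv: "id_blinfun o\<^sub>L \<phi>' p = id_blinfun"
    by (rule blinfun_eqI) (simp add: app)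
  obtain U V \<psi> \<psi>' where UV: "open U" "U \<subseteq> \<Omega>" "p \<in> U" "open V" "\<phi> p \<in> V" "homeomorphism U V \<phi> \<psi>"
    and d\<psi>: "\<And>y. y \<in> V \<Longrightarrow> (\<psi> has_derivative (\<psi>' y)) (at y)"
    and \<psi>': "\<And>y. y \<in> V \<Longrightarrow> \<psi>' y = inv (blinfun_apply (\<phi>' (\<psi> y)))"
    and bij: "\<And>y. y \<in> V \<Longrightarrow> bij (blinfun_apply (\<phi>' (\<psi> y)))"
    using inverse_function_theorem[OF opn der cont p(1) inv] by blast
  have \<psi>U: "\<psi> y \<in> U" if "y \<in> V" for y using UV(6) that by (auto simp: homeomorphism_def)
  have smU: "smooth_on_open U \<phi>"
    using smooth_on_openD(2)[OF smooth] UV(1,2) Ck_on_subset unfolding smooth_on_open_def by blast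
  have smV: "smooth_on_open V \<psi>"
  proof (rule smooth_on_open_inverse[OF smU UV(4) _ d\<psi>])
    show "\<psi> ` V \<subseteq> U" using \<psi>U by blast
    fix y v assume y: "y \<in> V"
    have eq: "frechet_derivative \<phi> (at (\<psi> y)) = blinfun_apply (\<phi>' (\<psi> y))" using ap \<psi>U[OF y] UV(2) by auto
    show "frechet_derivative \<phi> (at (\<psi> y)) (\<psi>' y v) = v"
      unfolding eq \<psi>'[OF y] by (rule surj_f_inv_f[OF bij_is_surj[OF bij[OF y]]])
    show "\<psi>' y (frechet_derivative \<phi> (at (\<psi> y)) v) = v"
      unfolding eq \<psi>'[OF y] by (rule inv_f_f[OF bij_is_inj[OF bij[OF y]]])
  qed
  have iff: "D (\<phi> x) = 0 \<longleftrightarrow> G x = 0" if "x \<in> \<Omega>" for x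
  proof -
    have "D (\<phi> x) = D x + (G x - D x)"
      unfolding \<phi>_def linear_add[OF linD] using R(2) GW[OF that] DW subspace_diff[OF W] by simp
    then show ?thesis by simp
  qed
  have img: "\<phi> ` (U \<inter> {x\<in>\<Omega>. G x = 0}) = V \<inter> {v. D v = 0}"
  proof (intro equalityI subsetI)
    fix y assume "y \<in> \<phi> ` (U \<inter> {x\<in>\<Omega>. G x = 0})"
    then show "y \<in> V \<inter> {v. D v = 0}" using iff UV(6) by (auto simp: homeomorphism_def)
  next
    fix y assume y: "y \<in> V \<inter> {v. D v = 0}"
    then have "\<phi> (\<psi> y) = y" "\<psi> y \<in> U" using UV(6) \<psi>U by (auto simp: homeomorphism_def)
    then show "y \<in> \<phi> ` (U \<inter> {x\<in>\<Omega>. G x = 0})"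
      using y iff[of "\<psi> y"] UV(2) by (intro image_eqI[of _ _ "\<psi> y"]) auto
  qed
  have "\<psi> (\<phi> p) = p" using UV(3,6) by (auto simp: homeomorphism_def)
  then have "\<psi>' (\<phi> p) = id" using \<psi>'[OF UV(5)] app inv_id by simp
  then have "(\<psi> has_derivative id) (at (\<phi> p))" using d\<psi>[OF UV(5)] by simp
  then show thesis using that[OF UV(3,2) smU smV UV(6) img] by blast
qed

lemma embedded_submanifold_level_set:
  fixes G :: "'a::euclidean_space \<Rightarrow> 'b::euclidean_space"
  assumes G: "smooth_on_open \<Omega> G" and W: "subspace W" and GW: "\<And>x. x \<in> \<Omega> \<Longrightarrow> G x \<in> W"
    and D: "\<And>p. p \<in> \<Omega> \<Longrightarrow> G p = 0 \<Longrightarrow> (G has_derivative D p) (at p)"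
    and surj: "\<And>p. p \<in> \<Omega> \<Longrightarrow> G p = 0 \<Longrightarrow> W \<subseteq> range (D p)"
  shows "embedded_submanifold (DIM('a) - dim W) {x\<in>\<Omega>. G x = 0}"
  unfolding embedded_submanifold_def
proof
  fix p assume "p \<in> {x\<in>\<Omega>. G x = 0}"
  then have p: "p \<in> \<Omega>" "G p = 0" by auto
  have lin: "linear (D p)" using D[OF p] has_derivative_linear by blast
  have "range (D p) = W"
    using surj[OF p] has_derivative_in_subspace[OF W D[OF p] smooth_on_openD(1)[OF G] p(1) GW] by blast
  then have dim: "dim {v. D p v = 0} = DIM('a) - dim W"
    using dim_kernel_plus_dim_range[OF lin] by simp
  obtain U V \<phi> \<psi> where ch: "p \<in> U" "smooth_on_open U \<phi>" "smooth_on_open V \<psi>"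
    "homeomorphism U V \<phi> \<psi>" "\<phi> ` (U \<inter> {x\<in>\<Omega>. G x = 0}) = V \<inter> {v. D p v = 0}"
    by (rule level_set_chart[OF G W GW p D[OF p] surj[OF p]]) blast+
  show "\<exists>U V \<phi> \<psi> L. p \<in> U \<and> smooth_on_open U \<phi> \<and> smooth_on_open V \<psi> \<and>
      homeomorphism U V \<phi> (\<psi> :: 'a \<Rightarrow> 'a) \<and> subspace L \<and> dim L = DIM('a) - dim W \<and>
      \<phi> ` (U \<inter> {x\<in>\<Omega>. G x = 0}) = V \<inter> L"
    by (rule exI[of _ U], rule exI[of _ V], rule exI[of _ \<phi>], rule exI[of _ \<psi>],
        rule exI[of _ "{v. D p v = 0}"], intro conjI ch dim linear_subspace_kernel[OF lin])
qed

text \<open>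
  A vector \<open>v\<close> in the kernel is the velocity of the inverse image, under the chart, of the line through
  \<open>\<phi> p\<close> with direction \<open>v\<close>.
\<close>

lemma tangent_space_level_set:
  fixes G :: "'a::euclidean_space \<Rightarrow> 'b::euclidean_space"
  assumes G: "smooth_on_open \<Omega> G" and W: "subspace W" and GW: "\<And>x. x \<in> \<Omega> \<Longrightarrow> G x \<in> W"
    and p: "p \<in> \<Omega>" "G p = 0" and D: "(G has_derivative D) (at p)" and surj: "W \<subseteq> range D"
  shows "tangent_space {x\<in>\<Omega>. G x = 0} p = {v. D v = 0}"
proof (intro equalityI subsetI)
  fix v assume "v \<in> tangent_space {x\<in>\<Omega>. G x = 0} p"
  then obtain c where c: "c 0 = p" "\<And>t::real. G (c t) = 0" "(c has_vector_derivative v) (at 0)"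
    unfolding tangent_space_def by blast
  have "((\<lambda>t. G (c t)) has_derivative (\<lambda>t. D (t *\<^sub>R v))) (at 0)"
    using has_derivative_compose[OF c(3)[unfolded has_vector_derivative_def], of G D] D c(1) by simp
  then have "((\<lambda>t. 0) has_derivative (\<lambda>t. D (t *\<^sub>R v))) (at (0::real))" using c(2) by simp
  then have "(\<lambda>t. D (t *\<^sub>R v)) = (\<lambda>t::real. 0)" using has_derivative_unique has_derivative_const by blast
  then have "D (1 *\<^sub>R v) = 0" by metis
  then show "v \<in> {v. D v = 0}" by simp
next
  fix v assume v: "v \<in> {v. D v = 0}"
  have lin: "linear D" using D has_derivative_linear by blast
  obtain U V \<phi> \<psi> where ch: "p \<in> U" "smooth_on_open V \<psi>"
    "homeomorphism U V \<phi> \<psi>" "\<phi> ` (U \<inter> {x\<in>\<Omega>. G x = 0}) = V \<inter> {v. D v = 0}"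
    "(\<psi> has_derivative id) (at (\<phi> p))"
    by (rule level_set_chart[OF G W GW p D surj]) blast+
  have \<phi>p: "\<phi> p \<in> V" "D (\<phi> p) = 0" "\<psi> (\<phi> p) = p"
    using ch(1,3,4) p by (auto simp: homeomorphism_def)
  define l where "l t = \<phi> p + t *\<^sub>R v" for t :: real
  \<comment> \<open>A tangent vector is the velocity of a curve defined on all of \<open>\<real>\<close>, so \<open>c\<close> needs a value where the
    line leaves the chart; the constant \<open>p\<close> stays in the level set.\<close>
  define c where "c t = (if l t \<in> V then \<psi> (l t) else p)" for t
  have l0: "l 0 = \<phi> p" by (simp add: l_def)
  have dl: "(l has_derivative (\<lambda>t. t *\<^sub>R v)) (at 0)"
    unfolding l_def by (auto intro!: derivative_eq_intros)
  have "((\<lambda>t. \<psi> (l t)) has_derivative (\<lambda>t. id (t *\<^sub>R v))) (at 0)"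
    using has_derivative_compose[OF dl, of \<psi> id] ch(5) l0 by simp
  moreover have "open (l -` V)"
    using smooth_on_openD(1)[OF ch(2)] unfolding l_def
    by (intro open_vimage continuous_intros)
  moreover have "0 \<in> l -` V" using \<phi>p(1) l0 by simp
  ultimately have "(c has_derivative (\<lambda>t. id (t *\<^sub>R v))) (at 0)"
    by (rule has_derivative_transform_within_open) (simp add: c_def)
  then have dc: "(c has_vector_derivative v) (at 0)" by (simp add: has_vector_derivative_def)
  have "c t \<in> {x\<in>\<Omega>. G x = 0}" for t
  proof (cases "l t \<in> V")
    case True
    have "D (l t) = 0" using v \<phi>p(2) unfolding l_def linear_add[OF lin] linear_scale[OF lin] by simp
    then have "l t \<in> \<phi> ` (U \<inter> {x\<in>\<Omega>. G x = 0})" using ch(4) True by blast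
    then obtain x where x: "l t = \<phi> x" "x \<in> U" "x \<in> {x\<in>\<Omega>. G x = 0}" by blast
    then have "\<psi> (l t) = x" using ch(3) by (simp add: homeomorphism_def)
    then show ?thesis using x(3) True by (simp add: c_def)
  next
    case False
    then show ?thesis using p by (simp add: c_def)
  qed
  moreover have "c 0 = p" using \<phi>p l0 by (simp add: c_def)
  ultimately show "v \<in> tangent_space {x\<in>\<Omega>. G x = 0} p"
    unfolding tangent_space_def using dc by blast
qed

section \<open>The Levi-Civita connection of an induced metric\<close>

lemma has_vector_derivative_along_curve:
  assumes f: "(f has_derivative D) (at p within S)"
    and c: "c 0 = p" "\<And>t::real. c t \<in> S" "(c has_vector_derivative v) (at 0)"
  shows "((\<lambda>t. f (c t)) has_vector_derivative D v) (at 0)"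
proof -
  have "((\<lambda>t. f (c t)) has_derivative (\<lambda>t. D (t *\<^sub>R v))) (at 0)"
  proof (rule has_derivative_in_compose[of c _ 0 UNIV f, simplified])
    show "(c has_derivative (\<lambda>t. t *\<^sub>R v)) (at 0)" using c(3) unfolding has_vector_derivative_def .
    show "(f has_derivative D) (at (c 0) within range c)"
      unfolding c(1) by (rule has_derivative_subset[OF f]) (use c(2) in blast)
  qed
  then show ?thesis
    using linear_scale[OF has_derivative_linear[OF f]] by (simp add: has_vector_derivative_def)
qed

text \<open>
  All derivatives of \<open>f\<close> within \<open>S\<close> agree on \<open>v\<close>, since their value is the derivative of \<open>f\<close> along a
  curve in \<open>S\<close> with velocity \<open>v\<close>.
\<close>

lemma tangential_derivative_eq:
  assumes f: "(f has_derivative D) (at p within S)" and v: "v \<in> tangent_space S p"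
  shows "tangential_derivative S f p v = D v"
  unfolding tangential_derivative_def
proof (rule the_equality)
  show "\<exists>D'. (f has_derivative D') (at p within S) \<and> D v = D' v" using f by blast
  fix w assume "\<exists>D'. (f has_derivative D') (at p within S) \<and> w = D' v"
  then obtain D' where D': "(f has_derivative D') (at p within S)" "w = D' v" by blast
  obtain c where c: "c 0 = p" "\<And>t::real. c t \<in> S" "(c has_vector_derivative v) (at 0)"
    using v unfolding tangent_space_def by blast
  show "w = D v" unfolding D'(2)
    using has_vector_derivative_along_curve[OF f c] has_vector_derivative_along_curve[OF D'(1) c]
    by (rule vector_derivative_unique_at[rotated])
qed

lemma smooth_map_on_has_derivative:
  assumes f: "smooth_map_on S f" and p: "p \<in> S"
  obtains D where "(f has_derivative D) (at p within S)"
proof -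
  obtain U h where h: "p \<in> U" "smooth_on_open U h" "\<forall>q\<in>S \<inter> U. h q = f q"
    using bspec[OF f[unfolded smooth_map_on_def] p] by blast
  obtain d where d: "d > 0" "\<forall>q. dist q p < d \<longrightarrow> q \<in> U"
    using smooth_on_openD(1)[OF h(2)] h(1) unfolding open_dist by meson
  have "(h has_derivative frechet_derivative h (at p)) (at p within S)"
    by (rule has_derivative_at_withinI[OF smooth_on_openD(3)[OF h(2,1)]])
  then have "(f has_derivative frechet_derivative h (at p)) (at p within S)"
    by (rule has_derivative_transform_within[OF _ d(1) p]) (use h(3) d(2) in auto)
  then show thesis by (rule that)
qed

lemma smooth_map_onI: "open U \<Longrightarrow> (\<And>k. Ck_on k U f) \<Longrightarrow> S \<subseteq> U \<Longrightarrow> smooth_map_on S f"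
  unfolding smooth_map_on_def smooth_on_open_def by blast

text \<open>
  The orthogonal projections onto the tangent spaces extend smoothly to the surrounding space. This gives
  global vector fields \<open>q \<mapsto> Pr q w\<close> through every tangent vector, without partitions of unity, and it
  gives the Levi-Civita connection of the induced metric as the projected derivative. The assumption on
  brackets makes that connection torsion-free.
\<close>

locale tangent_projection =
  fixes S :: "'a::euclidean_space set" and Pr :: "'a \<Rightarrow> 'a \<Rightarrow> 'a"
  assumes subspace_tangent: "p \<in> S \<Longrightarrow> subspace (tangent_space S p)"
    and linear_Pr: "linear (Pr q)"
    and smooth_Pr: "Ck_on k UNIV (\<lambda>q. Pr q w)"
    and Pr_tangent: "p \<in> S \<Longrightarrow> Pr p w \<in> tangent_space S p"
    and Pr_orthogonal: "p \<in> S \<Longrightarrow> v \<in> tangent_space S p \<Longrightarrow> (w - Pr p w) \<bullet> v = 0"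
    and lie_bracket_tangent: "vector_field S X \<Longrightarrow> vector_field S Y \<Longrightarrow> p \<in> S \<Longrightarrow>
      lie_bracket S X Y p \<in> tangent_space S p"
begin

lemma Pr_eq: "p \<in> S \<Longrightarrow> v \<in> tangent_space S p \<Longrightarrow> Pr p v = v"
proof -
  assume p: "p \<in> S" and v: "v \<in> tangent_space S p"
  have "(v - Pr p v) \<bullet> (v - Pr p v) = 0"
    by (rule Pr_orthogonal[OF p subspace_diff[OF subspace_tangent[OF p] v Pr_tangent[OF p]]])
  then show "Pr p v = v" by simp
qed

lemma inner_Pr: "p \<in> S \<Longrightarrow> v \<in> tangent_space S p \<Longrightarrow> Pr p w \<bullet> v = w \<bullet> v"
  using Pr_orthogonal[of p v w] by (simp add: inner_diff_left)

lemma extension_field: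
  assumes "p \<in> S" "w \<in> tangent_space S p"
  obtains Z where "vector_field S Z" "Z p = w"
proof (rule that[of "\<lambda>q. Pr q w"])
  show "vector_field S (\<lambda>q. Pr q w)"
    unfolding vector_field_def using smooth_map_onI[OF open_UNIV smooth_Pr subset_UNIV] Pr_tangent by blast
  show "Pr p w = w" using Pr_eq assms by blast
qed

definition connection :: "('a \<Rightarrow> 'a) \<Rightarrow> ('a \<Rightarrow> 'a) \<Rightarrow> 'a \<Rightarrow> 'a" where
  "connection X Y p = Pr p (tangential_derivative S Y p (X p))"

lemma connection_eq:
  assumes "(Y has_derivative D) (at p within S)" "X p \<in> tangent_space S p"
  shows "connection X Y p = Pr p (D (X p))"
  unfolding connection_def tangential_derivative_eq[OF assms] ..

lemma vector_field_connection:
  assumes X: "vector_field S X" and Y: "vector_field S Y"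
  shows "vector_field S (connection X Y)"
  unfolding vector_field_def
proof
  show "\<forall>p\<in>S. connection X Y p \<in> tangent_space S p"
    unfolding connection_def using Pr_tangent by blast
  show "smooth_map_on S (connection X Y)"
    unfolding smooth_map_on_def
  proof
    fix p assume p: "p \<in> S"
    obtain U h where h: "p \<in> U" "smooth_on_open U h" "\<forall>q\<in>S \<inter> U. h q = X q"
      using bspec[OF X[unfolded vector_field_def smooth_map_on_def, THEN conjunct1] p] by blast
    obtain V k where k: "p \<in> V" "smooth_on_open V k" "\<forall>q\<in>S \<inter> V. k q = Y q"
      using bspec[OF Y[unfolded vector_field_def smooth_map_on_def, THEN conjunct1] p] by blast
    have opn: "open (U \<inter> V)" using smooth_on_openD(1)[OF h(2)] smooth_on_openD(1)[OF k(2)] by (rule open_Int)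
    define K where "K q = Pr q (frechet_derivative k (at q) (h q))" for q
    have "Ck_on m (U \<inter> V) K" for m
      unfolding K_def
    proof (rule Ck_on_apply_linear[OF opn, where T = Pr])
      show "linear (Pr q)" for q by (rule linear_Pr)
      show "Ck_on m (U \<inter> V) (\<lambda>q. Pr q w)" for w
        by (rule Ck_on_subset[OF smooth_Pr subset_UNIV])
      show "Ck_on m (U \<inter> V) (\<lambda>q. frechet_derivative k (at q) (h q))"
      proof (rule Ck_on_apply_linear[OF opn, where T = "\<lambda>q. frechet_derivative k (at q)"])
        show "linear (frechet_derivative k (at q))" if "q \<in> U \<inter> V" for q
          using smooth_on_openD(3)[OF k(2), of q] that has_derivative_linear by blast
        show "Ck_on m (U \<inter> V) (\<lambda>q. frechet_derivative k (at q) v)" for v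
          by (rule Ck_on_subset[OF smooth_on_openD(2)[OF smooth_on_openD(4)[OF k(2)]]]) blast
        show "Ck_on m (U \<inter> V) h" by (rule Ck_on_subset[OF smooth_on_openD(2)[OF h(2)]]) blast
      qed
    qed
    then have sm: "smooth_on_open (U \<inter> V) K" using opn smooth_on_openI by blast
    have "K q = connection X Y q" if q: "q \<in> S \<inter> (U \<inter> V)" for q
    proof -
      have qV: "q \<in> V" and qS: "q \<in> S" using q by auto
      obtain d where d: "d > 0" "\<forall>x. dist x q < d \<longrightarrow> x \<in> V"
        using smooth_on_openD(1)[OF k(2)] qV unfolding open_dist by meson
      have "(k has_derivative frechet_derivative k (at q)) (at q within S)"
        by (rule has_derivative_at_withinI[OF smooth_on_openD(3)[OF k(2) qV]])
      then have "(Y has_derivative frechet_derivative k (at q)) (at q within S)"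
        by (rule has_derivative_transform_within[OF _ d(1) qS]) (use k(3) d(2) in auto)
      moreover have "X q \<in> tangent_space S q" using X q unfolding vector_field_def by blast
      ultimately show ?thesis using connection_eq h(3) q unfolding K_def by simp
    qed
    then show "\<exists>U h. p \<in> U \<and> smooth_on_open U h \<and> (\<forall>q\<in>S \<inter> U. h q = connection X Y q)"
      using sm h(1) k(1) by (intro exI[of _ "U \<inter> V"] exI[of _ K]) simp
  qed
qed

lemma vector_field_derivative:
  assumes "vector_field S Y" "p \<in> S"
  obtains D where "(Y has_derivative D) (at p within S)" "linear D"
proof -
  obtain D where "(Y has_derivative D) (at p within S)"
    using assms smooth_map_on_has_derivative unfolding vector_field_def by blast
  then show thesis using that has_derivative_linear by blast
qed

lemma vector_field_tangent: "vector_field S X \<Longrightarrow> p \<in> S \<Longrightarrow> X p \<in> tangent_space S p"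
  by (simp add: vector_field_def)

lemma levi_civita_connection_connection:
  assumes g: "\<And>p u v. p \<in> S \<Longrightarrow> g p u v = u \<bullet> v"
  shows "levi_civita_connection S g connection"
proof
  show "vector_field S (connection X Y)" if "vector_field S X" "vector_field S Y" for X Y
    using vector_field_connection that .
next
  fix X X' Y p assume A: "vector_field S X" "vector_field S X'" "vector_field S Y" "p \<in> S"
  obtain D where D: "(Y has_derivative D) (at p within S)" "linear D"
    using vector_field_derivative A(3,4) by blast
  have "X p + X' p \<in> tangent_space S p"
    using subspace_add[OF subspace_tangent] vector_field_tangent A by blast
  then show "connection (\<lambda>q. X q + X' q) Y p = connection X Y p + connection X' Y p"
    using connection_eq[OF D(1)] vector_field_tangent A linear_add[OF D(2)] linear_add[OF linear_Pr] by simp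
next
  fix f :: "'a \<Rightarrow> real" and X Y p assume A: "smooth_map_on S f" "vector_field S X" "vector_field S Y" "p \<in> S"
  obtain D where D: "(Y has_derivative D) (at p within S)" "linear D"
    using vector_field_derivative A(3,4) by blast
  have "f p *\<^sub>R X p \<in> tangent_space S p"
    using subspace_scale[OF subspace_tangent] vector_field_tangent A by blast
  then show "connection (\<lambda>q. f q *\<^sub>R X q) Y p = f p *\<^sub>R connection X Y p"
    using connection_eq[OF D(1)] vector_field_tangent A linear_scale[OF D(2)] linear_scale[OF linear_Pr] by simp
next
  fix X Y Y' p assume A: "vector_field S X" "vector_field S Y" "vector_field S Y'" "p \<in> S"
  obtain D where D: "(Y has_derivative D) (at p within S)" "linear D"
    using vector_field_derivative A(2,4) by blast
  obtain D' where D': "(Y' has_derivative D') (at p within S)" "linear D'"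
    using vector_field_derivative A(3,4) by blast
  show "connection X (\<lambda>q. Y q + Y' q) p = connection X Y p + connection X Y' p"
    using connection_eq[OF D(1)] connection_eq[OF D'(1)] connection_eq[OF has_derivative_add[OF D(1) D'(1)]]
      vector_field_tangent A linear_add[OF linear_Pr] by simp
next
  fix f :: "'a \<Rightarrow> real" and X Y p
  assume A: "smooth_map_on S f" "vector_field S X" "vector_field S Y" "p \<in> S"
  obtain D where D: "(Y has_derivative D) (at p within S)" "linear D"
    using vector_field_derivative A(3,4) by blast
  obtain d where d: "(f has_derivative d) (at p within S)"
    using smooth_map_on_has_derivative A(1,4) by blast
  have X: "X p \<in> tangent_space S p" using vector_field_tangent A by blast
  have "connection X (\<lambda>q. f q *\<^sub>R Y q) p = Pr p (f p *\<^sub>R D (X p) + d (X p) *\<^sub>R Y p)"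
    by (rule connection_eq[where X = X, OF has_derivative_scaleR[OF d D(1)] X])
  also have "\<dots> = f p *\<^sub>R Pr p (D (X p)) + d (X p) *\<^sub>R Y p"
    using Pr_eq[OF A(4) vector_field_tangent[OF A(3,4)]]
    by (simp add: linear_add[OF linear_Pr] linear_scale[OF linear_Pr])
  finally show "connection X (\<lambda>q. f q *\<^sub>R Y q) p =
      tangential_derivative S f p (X p) *\<^sub>R Y p + f p *\<^sub>R connection X Y p"
    using connection_eq[where X = X, OF D(1) X] tangential_derivative_eq[OF d X] by simp
next
  fix X Y p assume A: "vector_field S X" "vector_field S Y" "p \<in> S"
  have "connection X Y p - connection Y X p = Pr p (lie_bracket S X Y p)"
    unfolding connection_def lie_bracket_def linear_diff[OF linear_Pr] ..
  then show "connection X Y p - connection Y X p = lie_bracket S X Y p"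
    using Pr_eq lie_bracket_tangent A by simp
next
  fix X Y Z p assume A: "vector_field S X" "vector_field S Y" "vector_field S Z" "p \<in> S"
  obtain D where D: "(Y has_derivative D) (at p within S)" "linear D"
    using vector_field_derivative A(2,4) by blast
  obtain D' where D': "(Z has_derivative D') (at p within S)" "linear D'"
    using vector_field_derivative A(3,4) by blast
  have X: "X p \<in> tangent_space S p" using vector_field_tangent A by blast
  have "((\<lambda>q. Y q \<bullet> Z q) has_derivative (\<lambda>v. Y p \<bullet> D' v + D v \<bullet> Z p)) (at p within S)"
    by (rule has_derivative_inner[OF D(1) D'(1)])
  then have "((\<lambda>q. g q (Y q) (Z q)) has_derivative (\<lambda>v. Y p \<bullet> D' v + D v \<bullet> Z p)) (at p within S)"
    by (rule has_derivative_transform_within[OF _ zero_less_one A(4)]) (simp add: g)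
  then have "tangential_derivative S (\<lambda>q. g q (Y q) (Z q)) p (X p) = Y p \<bullet> D' (X p) + D (X p) \<bullet> Z p"
    by (rule tangential_derivative_eq[OF _ X])
  also have "\<dots> = Pr p (D (X p)) \<bullet> Z p + Y p \<bullet> Pr p (D' (X p))"
    using inner_Pr[OF A(4) vector_field_tangent[OF A(3,4)]] inner_Pr[OF A(4) vector_field_tangent[OF A(2,4)]]
    by (simp add: inner_commute)
  finally show "tangential_derivative S (\<lambda>q. g q (Y q) (Z q)) p (X p) =
      g p (connection X Y p) (Z p) + g p (Y p) (connection X Z p)"
    using connection_eq[where X = X, OF D(1) X] connection_eq[where X = X, OF D'(1) X] g[OF A(4)] by simp
qed

text \<open>
  Let \<open>B\<close> be the difference of the two connections. The form \<open>B X Y \<bullet> Z\<close> is symmetric in \<open>X, Y\<close> because both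
  are torsion-free and skew in \<open>Y, Z\<close> because both are metric. Using the two symmetries in turn, three times
  each, restores the order of the arguments and changes the sign, so the form is zero.
\<close>

lemma levi_civita_connection_unique:
  assumes g: "\<And>p u v. p \<in> S \<Longrightarrow> g p u v = u \<bullet> v"
    and N: "levi_civita_connection S g N" and N': "levi_civita_connection S g N'"
    and X: "vector_field S X" and Y: "vector_field S Y" and p: "p \<in> S"
  shows "N X Y p = N' X Y p"
proof -
  define B where "B X Y = N X Y p - N' X Y p" for X Y
  have sym: "B X Y = B Y X" if "vector_field S X" "vector_field S Y" for X Y
    using levi_civita_connection.torsion_free[OF N that p] levi_civita_connection.torsion_free[OF N' that p]
    unfolding B_def by (simp add: algebra_simps)
  have skew: "B X Y \<bullet> Z p = - (B X Z \<bullet> Y p)"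
    if "vector_field S X" "vector_field S Y" "vector_field S Z" for X Y Z
    using levi_civita_connection.metric[OF N that p] levi_civita_connection.metric[OF N' that p] g[OF p]
    unfolding B_def by (simp add: inner_diff_left inner_commute[of "Y p"])
  have T: "B X Y \<in> tangent_space S p"
    unfolding B_def
    using subspace_diff[OF subspace_tangent[OF p]] levi_civita_connection.field[OF N X Y]
      levi_civita_connection.field[OF N' X Y] vector_field_tangent p by blast
  obtain Z where Z: "vector_field S Z" "Z p = B X Y" using extension_field[OF p T] .
  have "B X Y \<bullet> Z p = - (B Z X \<bullet> Y p)" using skew[OF X Y Z(1)] sym[OF X Z(1)] by simp
  also have "\<dots> = B Y Z \<bullet> X p" using skew[OF Z(1) X Y] sym[OF Y Z(1)] by simp
  also have "\<dots> = - (B X Y \<bullet> Z p)" using skew[OF Y Z(1) X] sym[OF X Y] by simp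
  finally have "B X Y \<bullet> B X Y = 0" using Z(2) by simp
  then show ?thesis by (simp add: B_def)
qed

lemma levi_civita_eq:
  assumes g: "\<And>p u v. p \<in> S \<Longrightarrow> g p u v = u \<bullet> v"
    and XY: "vector_field S X" "vector_field S Y" "p \<in> S"
  shows "levi_civita S g X Y p = connection X Y p"
proof (rule levi_civita_connection_unique[OF g _ _ XY])
  show "levi_civita_connection S g (levi_civita S g)"
    unfolding levi_civita_def
    by (rule someI[of "levi_civita_connection S g" connection])
       (rule levi_civita_connection_connection, rule g)
  show "levi_civita_connection S g connection" by (rule levi_civita_connection_connection) (rule g)
qed

end


section \<open>A criterion for vanishing mean curvature\<close>

lemma normal_component_unique:
  assumes "subspace (tangent_space S p)" "subspace (tangent_space M p)"
    and g: "\<And>u v. g p u v = u \<bullet> v"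
    and u: "u \<in> tangent_space S p" "w - u \<in> tangent_space M p" "\<And>v. v \<in> tangent_space M p \<Longrightarrow> u \<bullet> v = 0"
  shows "normal_component S g M p w = u"
  unfolding normal_component_def
proof (rule the_equality)
  show "u \<in> tangent_space S p \<and> w - u \<in> tangent_space M p \<and> (\<forall>v\<in>tangent_space M p. g p u v = 0)"
    using u g by simp
  fix u' assume u': "u' \<in> tangent_space S p \<and> w - u' \<in> tangent_space M p \<and> (\<forall>v\<in>tangent_space M p. g p u' v = 0)"
  have d: "u - u' \<in> tangent_space M p"
    using subspace_diff[OF assms(2), of "w - u'" "w - u"] u(2) u' by simp
  then have "(u - u') \<bullet> (u - u') = 0"
    using u(3)[OF d] u' g by (simp add: inner_diff_left)
  then show "u' = u" by simp
qed

lemma normal_component_props: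
  assumes S: "subspace (tangent_space S p)" and M: "subspace (tangent_space M p)"
    and sub: "tangent_space M p \<subseteq> tangent_space S p"
    and g: "\<And>u v. g p u v = u \<bullet> v" and w: "w \<in> tangent_space S p"
  shows "normal_component S g M p w \<in> tangent_space S p"
    "w - normal_component S g M p w \<in> tangent_space M p"
    "v \<in> tangent_space M p \<Longrightarrow> normal_component S g M p w \<bullet> v = 0"
proof -
  obtain y z where yz: "y \<in> span (tangent_space M p)"
    "\<And>v. v \<in> span (tangent_space M p) \<Longrightarrow> orthogonal z v" "w = y + z"
    using orthogonal_subspace_decomp_exists by blast
  have y: "y \<in> tangent_space M p" using yz(1) span_eq_iff M by blast
  have z: "z \<in> tangent_space S p" using subspace_diff[OF S w, of y] y sub yz(3) by auto
  have eq: "normal_component S g M p w = z"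
    by (rule normal_component_unique[where g = g, OF S M g z])
       (use y yz(2,3) span_base in \<open>auto simp: orthogonal_def\<close>)
  show "normal_component S g M p w \<in> tangent_space S p"
    "w - normal_component S g M p w \<in> tangent_space M p"
    "v \<in> tangent_space M p \<Longrightarrow> normal_component S g M p w \<bullet> v = 0"
    unfolding eq using y z yz(2,3) span_base by (auto simp: orthogonal_def)
qed

text \<open>
  A vector tangent to \<open>S\<close> and normal to \<open>M\<close> is determined by its image under \<open>dF\<close>, whose kernel on the
  tangent space of \<open>S\<close> is the tangent space of \<open>M\<close>. If the values of \<open>dF\<close> on the second fundamental form
  are given by a function \<open>h\<close> of the vector, then the second fundamental form is well defined on the diagonal, and its trace
  vanishes as soon as the trace of \<open>h\<close> does.
\<close>

lemma mean_curvature_eq_0I: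
  fixes dF :: "'a::euclidean_space \<Rightarrow> 'c::real_vector"
  assumes S: "subspace (tangent_space S p)" and M: "subspace (tangent_space M p)"
    and g: "\<And>u v. g p u v = u \<bullet> v"
    and dF: "linear dF" and TM: "tangent_space M p = {v \<in> tangent_space S p. dF v = 0}"
    and ext: "\<And>v. v \<in> tangent_space M p \<Longrightarrow>
      \<exists>X. vector_field S X \<and> (\<forall>q\<in>M. X q \<in> tangent_space M q) \<and> X p = v"
    and lc: "\<And>X Y. vector_field S X \<Longrightarrow> vector_field S Y \<Longrightarrow>
      levi_civita S g X Y p \<in> tangent_space S p"
    and hess: "\<And>X Y. vector_field S X \<Longrightarrow> vector_field S Y \<Longrightarrow>
      \<forall>q\<in>M. X q \<in> tangent_space M q \<and> Y q \<in> tangent_space M q \<Longrightarrow> X p = Y p \<Longrightarrow>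
      X p \<in> tangent_space M p \<Longrightarrow> dF (levi_civita S g X Y p) = h (X p)"
    and tr: "\<And>E. finite E \<Longrightarrow> span E = tangent_space M p \<Longrightarrow>
      (\<And>u v. u \<in> E \<Longrightarrow> v \<in> E \<Longrightarrow> u \<bullet> v = (if u = v then 1 else 0)) \<Longrightarrow> (\<Sum>v\<in>E. h v) = 0"
  shows "mean_curvature S g M p = 0"
proof -
  have sub: "tangent_space M p \<subseteq> tangent_space S p" using TM by blast
  define sff where "sff = second_fundamental_form S g M p"
  have sff: "sff v v \<in> tangent_space S p \<and> dF (sff v v) = h v \<and>
      (\<forall>u\<in>tangent_space M p. sff v v \<bullet> u = 0)" if v: "v \<in> tangent_space M p" for v
  proof -
    define adm where "adm b X Y \<longleftrightarrow> vector_field S X \<and> vector_field S Y \<and>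
        (\<forall>q\<in>M. X q \<in> tangent_space M q \<and> Y q \<in> tangent_space M q) \<and> X p = v \<and> Y p = v \<and>
        b = normal_component S g M p (levi_civita S g X Y p)" for b X Y
    have props: "b \<in> tangent_space S p \<and> dF b = h v \<and> (\<forall>u\<in>tangent_space M p. b \<bullet> u = 0)"
      if adm: "adm b X Y" for b X Y
    proof -
      define w where "w = levi_civita S g X Y p"
      have w: "w \<in> tangent_space S p" "dF w = h v"
        using lc[of X Y] hess[of X Y] adm v unfolding w_def adm_def by auto
      have b: "b = normal_component S g M p w" using adm unfolding w_def adm_def by blast
      note n = normal_component_props[where g = g and p = p, OF S M sub g w(1), folded b]
      have "dF (w - b) = 0" using n(2) TM by blast
      then have "dF b = h v" using w(2) linear_diff[OF dF] by simp
      then show ?thesis using n(1,3) by blast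
    qed
    have uniq: "b = b'" if "adm b X Y" "adm b' X' Y'" for b X Y b' X' Y'
    proof -
      note P = props[OF that(1)] props[OF that(2)]
      have "b - b' \<in> tangent_space S p" using subspace_diff[OF S] P by blast
      moreover have "dF (b - b') = 0" using P linear_diff[OF dF] by simp
      ultimately have "b - b' \<in> tangent_space M p" using TM by blast
      then have "(b - b') \<bullet> (b - b') = 0" using P by (simp add: inner_diff_left)
      then show ?thesis by simp
    qed
    obtain X where X: "vector_field S X" "\<forall>q\<in>M. X q \<in> tangent_space M q" "X p = v"
      using ext[OF v] by blast
    define b where "b = normal_component S g M p (levi_civita S g X X p)"
    have adm: "adm b X X" unfolding adm_def b_def using X by blast
    have "sff v v = (THE b. \<exists>X Y. adm b X Y)"
      unfolding sff_def second_fundamental_form_def adm_def ..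
    also have "\<dots> = b" using adm uniq[OF _ adm] by (intro the_equality) blast+
    finally show ?thesis using props[OF adm] by simp
  qed
  have zero: "(\<Sum>v\<in>E. sff v v) = 0" if E: "orthonormal_basis_of (g p) (tangent_space M p) E" for E
  proof -
    have E': "finite E" "span E = tangent_space M p" "\<And>u v. u \<in> E \<Longrightarrow> v \<in> E \<Longrightarrow> u \<bullet> v = (if u = v then 1 else 0)"
      using E g unfolding orthonormal_basis_of_def by auto
    have ET: "v \<in> tangent_space M p" if "v \<in> E" for v using E'(2) that span_base by blast
    define m where "m = (\<Sum>v\<in>E. sff v v)"
    have "m \<in> tangent_space S p" unfolding m_def by (rule subspace_sum[OF S]) (use sff ET in blast)
    moreover have "dF m = 0"
      unfolding m_def linear_sum[OF dF] using sff ET tr[OF E'] by simp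
    ultimately have "m \<in> tangent_space M p" using TM by blast
    then have "sff v v \<bullet> m = 0" if "v \<in> E" for v using sff[OF ET[OF that]] by blast
    then have "m \<bullet> m = 0" using inner_sum_left[of "\<lambda>v. sff v v" E m] by (simp add: m_def[symmetric])
    then show ?thesis by (simp add: m_def)
  qed
  obtain E where "pairwise orthogonal E" "\<And>x. x \<in> E \<Longrightarrow> norm x = 1" "independent E" "span E = tangent_space M p"
    by (rule orthonormal_basis_subspace[OF M]) blast
  then have E: "orthonormal_basis_of (g p) (tangent_space M p) E"
    unfolding orthonormal_basis_of_def
    using g independent_imp_finite by (auto simp: pairwise_def orthogonal_def norm_eq_1)
  show ?thesis
    unfolding mean_curvature_def sff_def[symmetric]
    by (rule the_equality) (use E zero in metis)+
qed

section \<open>Complex matrices\<close>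

type_synonym 'n cmat = "complex^'n^'n"

abbreviation ct :: "'n::finite cmat \<Rightarrow> 'n cmat" where
  "ct \<equiv> conjugate_transpose"

lemma ct_nth [simp]: "ct A $ i $ j = cnj (A $ j $ i)"
  by (simp add: conjugate_transpose_def)

lemma mult_nth: "((A::'n::finite cmat) ** B) $ i $ j = (\<Sum>k\<in>UNIV. A $ i $ k * B $ k $ j)"
  by (simp add: matrix_matrix_mult_def)

lemma mat_nth: "(mat c :: 'n::finite cmat) $ i $ j = (if i = j then c else 0)"
  by (simp add: mat_def)

lemma mat_mult_nth: "(mat c ** (A::'n::finite cmat)) $ i $ j = c * A $ i $ j"
proof -
  have "(mat c ** A) $ i $ j = (\<Sum>k\<in>UNIV. if i = k then c * A $ k $ j else 0)"
    unfolding mult_nth mat_nth by (rule sum.cong) auto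
  then show ?thesis by simp
qed

lemma trace_mat_mult: "trace (mat c ** (A::'n::finite cmat)) = c * trace A"
  by (simp add: trace_def mat_mult_nth sum_distrib_left)

lemma ct_ct [simp]: "ct (ct A) = A"
  by (simp add: vec_eq_iff)

lemma ct_mult: "ct (A ** B) = ct B ** ct A"
  by (simp add: vec_eq_iff mult_nth mult.commute)

lemma ct_mat: "ct (mat c) = mat (cnj c)"
  by (auto simp add: vec_eq_iff mat_nth)

lemma ct_mat_1 [simp]: "ct (mat 1) = mat 1"
  by (simp add: ct_mat)

lemma ct_0 [simp]: "ct 0 = 0" and ct_add: "ct (A + B) = ct A + ct B"
  and ct_diff: "ct (A - B) = ct A - ct B" and ct_minus: "ct (- A) = - ct A"
  and ct_scaleR: "ct (r *\<^sub>R A) = r *\<^sub>R ct A"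
  by (simp_all add: vec_eq_iff)

lemma bounded_linear_ct: "bounded_linear ct"
  by (intro linear_conv_bounded_linear[THEN iffD1] linearI) (simp_all add: ct_add ct_scaleR)

lemma bounded_linear_nth: "bounded_linear (\<lambda>A::'n::finite cmat. A $ i $ j)"
  by (intro linear_conv_bounded_linear[THEN iffD1] linearI) simp_all

lemma bounded_linear_mat: "bounded_linear (mat :: complex \<Rightarrow> 'n::finite cmat)"
  by (intro linear_conv_bounded_linear[THEN iffD1] linearI) (auto simp: vec_eq_iff mat_nth)

lemma bounded_linear_trace: "bounded_linear (trace :: 'n::finite cmat \<Rightarrow> complex)"
  by (intro linear_conv_bounded_linear[THEN iffD1] linearI)
     (simp_all add: trace_def sum.distrib scaleR_right.sum)

lemma bounded_bilinear_matrix_mult: "bounded_bilinear ((**) :: 'n::finite cmat \<Rightarrow> 'n cmat \<Rightarrow> 'n cmat)"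
  unfolding bilinear_conv_bounded_bilinear[symmetric] bilinear_def
  by (intro conjI allI linearI)
     (simp_all add: vec_eq_iff mult_nth algebra_simps sum.distrib scaleR_right.sum)

lemma bounded_linear_mult_left: "bounded_linear (\<lambda>B. (A :: 'n::finite cmat) ** (B :: 'n cmat))"
  by (rule bounded_bilinear.bounded_linear_right[OF bounded_bilinear_matrix_mult])

lemmas matrix_mult_simps = bounded_bilinear.add_right[OF bounded_bilinear_matrix_mult]
  bounded_bilinear.add_left[OF bounded_bilinear_matrix_mult]
  bounded_bilinear.diff_right[OF bounded_bilinear_matrix_mult]
  bounded_bilinear.diff_left[OF bounded_bilinear_matrix_mult]
  bounded_bilinear.minus_right[OF bounded_bilinear_matrix_mult]
  bounded_bilinear.minus_left[OF bounded_bilinear_matrix_mult]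
  bounded_bilinear.scaleR_right[OF bounded_bilinear_matrix_mult]
  bounded_bilinear.scaleR_left[OF bounded_bilinear_matrix_mult]
  bounded_bilinear.zero_right[OF bounded_bilinear_matrix_mult]
  bounded_bilinear.zero_left[OF bounded_bilinear_matrix_mult]

lemma trace_simps:
  "trace (A + B) = trace A + trace (B :: 'n::finite cmat)" "trace (A - B) = trace A - trace B"
  "trace (- A) = - trace A" "trace (r *\<^sub>R A) = of_real r * trace A" "trace (0 :: 'n cmat) = 0"
  "trace (mat c :: 'n cmat) = of_nat CARD('n) * c" "trace (ct A) = cnj (trace A)"
  by (simp_all add: trace_def sum.distrib sum_subtractf sum_negf sum_distrib_left mat_nth scaleR_conv_of_real[where 'a = complex])

lemma inner_eq_trace: "A \<bullet> B = Re (trace (A ** ct (B :: 'n::finite cmat)))"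
  by (simp add: inner_vec_def trace_def mult_nth inner_complex_def)

lemma inner_ct: "ct A \<bullet> ct B = A \<bullet> (B :: 'n::finite cmat)"
  unfolding inner_vec_def by (subst sum.swap) (simp add: inner_complex_def)

lemma inner_mult_left: "(Q ** A) \<bullet> B = A \<bullet> (ct Q ** (B :: 'n::finite cmat))"
  unfolding inner_eq_trace ct_mult ct_ct
  by (metis matrix_mul_assoc trace_mul_sym)

section \<open>The special unitary Lie algebra\<close>

definition su :: "'n::finite cmat set" where
  "su = {X. ct X = - X \<and> trace X = 0}"

lemma subspace_su: "subspace su"
  unfolding subspace_def su_def by (simp add: ct_add ct_scaleR trace_simps)

lemma trace_skew:
  assumes "ct X = - X"
  shows "Re (trace X) = 0"
proof -
  have "cnj (trace X) = - trace X" using assms trace_simps(3,7) by metis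
  then show ?thesis by (simp add: complex_eq_iff)
qed

text \<open>
  The orthogonal projection onto \<open>su\<close>: the skew-Hermitian part of \<open>B\<close> has the purely imaginary trace
  \<open>\<i> * Im (trace B)\<close>, which is removed by a multiple of the identity.
\<close>

definition su_proj :: "'n::finite cmat \<Rightarrow> 'n cmat" where
  "su_proj B = (1/2) *\<^sub>R (B - ct B) - mat (\<i> * (Im (trace B) / CARD('n)))"

lemma bounded_linear_su_proj: "bounded_linear su_proj"
  unfolding linear_conv_bounded_linear[symmetric] su_proj_def
  by (rule linearI) (auto simp: vec_eq_iff mat_nth trace_simps algebra_simps add_divide_distrib complex_eq_iff)

lemma su_proj_in_su: "su_proj (B :: 'n::finite cmat) \<in> su"
proof -
  have "ct (su_proj B) = - su_proj B"
    by (auto simp add: su_proj_def ct_add ct_diff ct_scaleR ct_mat vec_eq_iff mat_nth complex_eq_iff field_simps)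
  moreover have "trace (su_proj B :: 'n cmat) = 0"
    by (simp add: su_proj_def trace_simps complex_eq_iff)
  ultimately show ?thesis by (simp add: su_def)
qed

lemma inner_mat_su: "Y \<in> su \<Longrightarrow> mat c \<bullet> Y = 0"
proof -
  assume Y: "Y \<in> su"
  have "mat c \<bullet> Y = Re (c * cnj (trace Y))"
    by (simp add: inner_eq_trace trace_mat_mult trace_simps)
  then show ?thesis using Y by (simp add: su_def)
qed

lemma inner_hermitian_skew:
  assumes "ct A = A" "ct Y = - Y"
  shows "A \<bullet> Y = 0"
  using inner_ct[of A Y] assms by simp

lemma su_proj_orthogonal:
  fixes B Y :: "'n::finite cmat"
  assumes "Y \<in> su"
  shows "(B - su_proj B) \<bullet> Y = 0"
proof -
  have "B - su_proj B = (1/2) *\<^sub>R (B + ct B) + mat (\<i> * (Im (trace B) / CARD('n)))"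
    by (auto simp add: su_proj_def vec_eq_iff complex_eq_iff field_simps)
  moreover have "(B + ct B) \<bullet> Y = 0"
    using assms by (intro inner_hermitian_skew) (auto simp: su_def ct_add)
  ultimately show ?thesis by (simp add: inner_add_left inner_mat_su[OF assms])
qed

lemma su_proj_su:
  assumes "Y \<in> su"
  shows "su_proj Y = Y"
proof -
  have "(Y - su_proj Y) \<bullet> (Y - su_proj Y) = 0"
    by (rule su_proj_orthogonal[OF subspace_diff[OF subspace_su assms su_proj_in_su]])
  then show ?thesis by simp
qed

lemma su_proj_hermitian:
  assumes "ct A = A"
  shows "su_proj A = 0"
proof -
  have "cnj (trace A) = trace A" using assms trace_simps(7) by metis
  then have "Im (trace A) = 0" by (simp add: complex_eq_iff)
  then show ?thesis using assms by (simp add: su_proj_def vec_eq_iff mat_nth)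
qed

section \<open>The determinant\<close>

lemma det_ct: "det (ct A) = cnj (det (A :: 'n::finite cmat))"
proof -
  have "det (ct A) = det (transpose (ct A))" by (simp add: det_transpose)
  also have "transpose (ct A) = (\<chi> i j. cnj (A $ i $ j))"
    by (simp add: vec_eq_iff transpose_def)
  also have "det \<dots> = cnj (det A)" by (simp add: det_def)
  finally show ?thesis .
qed

lemma Ck_on_det: "Ck_on k UNIV (det :: 'n::finite cmat \<Rightarrow> complex)"
  unfolding det_def[abs_def]
  by (intro Ck_on_sum Ck_on_mult Ck_on_prod Ck_on_const Ck_on_linear bounded_linear_nth open_UNIV)

text \<open>
  A permutation other than the identity moves at least two indices. After differentiating one factor of its
  product in the Leibniz formula, another factor still vanishes at the identity matrix.
\<close>

lemma has_derivative_det_mat_1: "((det :: 'n::finite cmat \<Rightarrow> complex) has_derivative trace) (at (mat 1))"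
proof -
  let ?P = "{\<sigma>. \<sigma> permutes (UNIV :: 'n set)}"
  let ?D = "\<lambda>V::'n cmat. \<Sum>\<sigma>\<in>?P. of_int (sign \<sigma>) *
      (\<Sum>i\<in>UNIV. V $ i $ \<sigma> i * (\<Prod>j\<in>UNIV - {i}. mat 1 $ j $ \<sigma> j))"
  have 1: "((det :: 'n cmat \<Rightarrow> complex) has_derivative ?D) (at (mat 1))"
    unfolding det_def[abs_def]
    by (intro has_derivative_sum has_derivative_mult_right has_derivative_prod
        bounded_linear.has_derivative[OF bounded_linear_nth] has_derivative_ident)
  have "?D V = trace V" for V :: "'n cmat"
  proof -
    have other: "of_int (sign \<sigma>) * (\<Sum>i\<in>UNIV. V $ i $ \<sigma> i * (\<Prod>j\<in>UNIV - {i}. mat 1 $ j $ \<sigma> j)) = 0"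
      if "\<sigma> \<in> ?P - {id}" for \<sigma>
    proof -
      have z: "(\<Prod>j\<in>UNIV - {i}. (mat 1 :: 'n cmat) $ j $ \<sigma> j) = 0" for i
      proof -
        have "\<sigma> \<noteq> id" using that by blast
        then obtain j where j: "\<sigma> j \<noteq> j" by fastforce
        have inj: "inj \<sigma>" using that by (auto intro: permutes_inj)
        then have "\<sigma> (\<sigma> j) \<noteq> \<sigma> j" using j by (metis injD)
        then have "\<exists>k\<in>UNIV - {i}. (mat 1 :: 'n cmat) $ k $ \<sigma> k = 0"
          using j by (cases "i = j") (auto simp: mat_nth intro: bexI[of _ "\<sigma> j"] bexI[of _ j])
        then show ?thesis by (simp add: prod_zero_iff)
      qed
      show ?thesis by (simp only: z mult_zero_right sum.neutral_const)
    qed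
    have "?D V = (\<Sum>\<sigma>\<in>{id}. of_int (sign \<sigma>) *
        (\<Sum>i\<in>UNIV. V $ i $ \<sigma> i * (\<Prod>j\<in>UNIV - {i}. mat 1 $ j $ \<sigma> j)))"
      by (rule sum.mono_neutral_right) (use other in \<open>auto simp: permutes_id finite_permutations\<close>)
    also have "\<dots> = trace V" by (simp add: trace_def mat_nth sign_id)
    finally show ?thesis .
  qed
  then show ?thesis using 1 by simp
qed

section \<open>The special unitary group\<close>

lemma special_unitaryD:
  assumes "z \<in> special_unitary"
  shows "z ** ct z = mat 1" "ct z ** z = mat 1" "det z = 1" "matrix_inv z = ct z"
proof -
  show 1: "z ** ct z = mat 1" and "det z = 1" using assms by (auto simp: special_unitary_def)
  then show "ct z ** z = mat 1" by (simp add: matrix_left_right_inverse)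
  with 1 show "matrix_inv z = ct z"
    unfolding matrix_inv_def
    by (intro some_equality) (auto, metis matrix_mul_assoc matrix_mul_lid matrix_mul_rid)
qed

lemma ct_mult_cancel: "z \<in> special_unitary \<Longrightarrow> ct z ** (z ** A) = A"
  and mult_ct_cancel: "z \<in> special_unitary \<Longrightarrow> z ** (ct z ** A) = A"
  by (simp_all add: matrix_mul_assoc special_unitaryD)

lemma special_unitary_metric_eq_inner:
  "z \<in> special_unitary \<Longrightarrow> special_unitary_metric z V W = V \<bullet> W"
  unfolding special_unitary_metric_def inner_eq_trace[symmetric]
  by (simp add: special_unitaryD inner_mult_left mult_ct_cancel)

definition det_domain :: "'n::finite cmat set" where
  "det_domain = {z. Re (det z) > 0}"

text \<open>
  The determinant of a unitary matrix has modulus one, so on \<open>det_domain\<close> it equals one as soon as its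
  imaginary part vanishes. Using only the imaginary part makes the equations independent.
\<close>

definition su_eqn :: "'n::finite cmat \<Rightarrow> 'n cmat \<times> real" where
  "su_eqn z = (ct z ** z - mat 1, Im (det z))"

definition su_eqn_deriv :: "'n::finite cmat \<Rightarrow> 'n cmat \<Rightarrow> 'n cmat \<times> real" where
  "su_eqn_deriv p V = (ct V ** p + ct p ** V, Im (trace (ct p ** V)))"

definition su_eqn_range :: "('n::finite cmat \<times> real) set" where
  "su_eqn_range = {A. ct A = A} \<times> UNIV"

lemma special_unitary_level_set: "(special_unitary :: 'n::finite cmat set) = {z\<in>det_domain. su_eqn z = 0}"
proof (intro equalityI subsetI)
  fix z :: "'n cmat" assume "z \<in> special_unitary"
  then show "z \<in> {z\<in>det_domain. su_eqn z = 0}"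
    by (simp add: special_unitaryD det_domain_def su_eqn_def zero_prod_def)
next
  fix z :: "'n cmat" assume "z \<in> {z\<in>det_domain. su_eqn z = 0}"
  then have z: "Re (det z) > 0" "ct z ** z = mat 1" "Im (det z) = 0"
    by (auto simp: det_domain_def su_eqn_def zero_prod_def)
  have "cnj (det z) * det z = 1" using z(2) det_mul[of "ct z" z] by (simp add: det_ct)
  then have "Re (det z) * Re (det z) = 1" using z(3) by (simp add: complex_eq_iff)
  then have "(Re (det z))\<^sup>2 = 1" by (simp add: power2_eq_square)
  then have "Re (det z) = 1" using z(1) by (auto simp: power2_eq_1_iff)
  then have "det z = 1" using z(3) by (simp add: complex_eq_iff)
  then show "z \<in> special_unitary" using z(2) by (simp add: special_unitary_def matrix_left_right_inverse)
qed

lemma open_det_domain: "open (det_domain :: 'n::finite cmat set)"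
proof -
  have "continuous_on UNIV (\<lambda>z::'n cmat. Re (det z))"
    using Ck_on_imp_continuous_on[OF Ck_on_det] by (rule continuous_on_Re)
  then show ?thesis unfolding det_domain_def
    using open_Collect_less[OF continuous_on_const] by auto
qed

lemma Ck_on_matrix_mult:
  fixes f g :: "'a::euclidean_space \<Rightarrow> 'n::finite cmat"
  assumes "open U" "Ck_on k U f" "Ck_on k U g"
  shows "Ck_on k U (\<lambda>x. f x ** g x)"
  using Ck_on_bilinear[OF assms(1) bounded_bilinear_matrix_mult assms(2,3)] .

lemma Ck_on_ct:
  fixes f :: "'a::euclidean_space \<Rightarrow> 'n::finite cmat"
  assumes "open U" "Ck_on k U f"
  shows "Ck_on k U (\<lambda>x. ct (f x))"
  using Ck_on_linear_compose[OF assms(1) bounded_linear_ct assms(2)] .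

lemma Ck_on_ident: "open U \<Longrightarrow> Ck_on k U (\<lambda>x. x)"
  by (rule Ck_on_linear[OF _ bounded_linear_ident])

lemma Ck_on_diff:
  assumes "open U" "Ck_on k U f" "Ck_on k U g"
  shows "Ck_on k U (\<lambda>x. f x - g x)"
  using Ck_on_add[OF assms(1,2) Ck_on_linear_compose[OF assms(1) bounded_linear_minus[OF bounded_linear_ident] assms(3)]]
  by simp

lemma Ck_on_Pair:
  assumes "open U" "Ck_on k U f" "Ck_on k U g"
  shows "Ck_on k U (\<lambda>x. (f x, g x))"
  using Ck_on_add[OF assms(1)
      Ck_on_linear_compose[OF assms(1) bounded_linear_Pair[OF bounded_linear_ident bounded_linear_zero] assms(2)]
      Ck_on_linear_compose[OF assms(1) bounded_linear_Pair[OF bounded_linear_zero bounded_linear_ident] assms(3)]]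
  by simp

lemma smooth_su_eqn: "smooth_on_open det_domain (su_eqn :: 'n::finite cmat \<Rightarrow> _)"
proof (rule smooth_on_openI[OF open_det_domain])
  fix k
  show "Ck_on k det_domain (su_eqn :: 'n cmat \<Rightarrow> _)"
    unfolding su_eqn_def[abs_def]
    by (intro Ck_on_Pair Ck_on_diff Ck_on_matrix_mult Ck_on_ct Ck_on_ident Ck_on_const open_det_domain
        Ck_on_linear_compose[OF open_det_domain bounded_linear_Im] Ck_on_subset[OF Ck_on_det subset_UNIV])
qed

lemma su_eqn_in_range: "su_eqn z \<in> su_eqn_range"
  by (simp add: su_eqn_def su_eqn_range_def ct_diff ct_mult)

lemma subspace_su_eqn_range: "subspace (su_eqn_range :: ('n::finite cmat \<times> real) set)"
  unfolding su_eqn_range_def subspace_def by (auto simp: ct_add ct_scaleR zero_prod_def)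

lemma has_derivative_det_su:
  assumes p: "p \<in> special_unitary"
  shows "(det has_derivative (\<lambda>V. trace (ct p ** V))) (at p)"
proof -
  have "((\<lambda>z. det (ct p ** z)) has_derivative (\<lambda>V. trace (ct p ** V))) (at p)"
    by (rule has_derivative_compose[OF bounded_linear.has_derivative[OF bounded_linear_mult_left has_derivative_ident]])
       (simp add: special_unitaryD[OF p] has_derivative_det_mat_1)
  moreover have "det (ct p ** z) = det z" for z
    by (simp add: det_mul det_ct special_unitaryD[OF p])
  ultimately show ?thesis by simp
qed

lemma has_derivative_su_eqn:
  assumes p: "p \<in> special_unitary"
  shows "(su_eqn has_derivative su_eqn_deriv p) (at p)"
proof -
  have "(su_eqn has_derivative (\<lambda>V. (ct p ** V + ct V ** p - 0, Im (trace (ct p ** V))))) (at p)"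
    unfolding su_eqn_def[abs_def]
    by (intro has_derivative_Pair has_derivative_diff has_derivative_const has_derivative_ident
        bounded_bilinear.FDERIV[OF bounded_bilinear_matrix_mult] bounded_linear.has_derivative[OF bounded_linear_ct]
        bounded_linear.has_derivative[OF bounded_linear_Im] has_derivative_det_su p)
  then show ?thesis by (simp add: su_eqn_deriv_def[abs_def] add.commute)
qed


lemma su_eqn_deriv_surj:
  assumes p: "p \<in> special_unitary" and A: "ct A = A"
  shows "su_eqn_deriv p (p ** ((1/2) *\<^sub>R A + mat (\<i> * (r / CARD('n))))) = (A :: 'n::finite cmat, r)"
proof -
  define X where "X = (1/2) *\<^sub>R A + mat (\<i> * (r / CARD('n)))"
  have "cnj (trace A) = trace A" using A trace_simps(7) by metis
  then have im: "Im (trace A) = 0" by (simp add: complex_eq_iff)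
  have "ct X + X = A"
    by (simp add: X_def ct_add ct_scaleR A ct_mat vec_eq_iff mat_nth complex_eq_iff)
  moreover have "Im (trace X) = r" using im by (simp add: X_def trace_simps)
  ultimately show ?thesis
    unfolding X_def[symmetric]
    by (simp add: su_eqn_deriv_def ct_mult ct_mult_cancel[OF p] matrix_mul_assoc[symmetric] special_unitaryD[OF p])
qed

lemma su_eqn_range_surj:
  assumes p: "p \<in> (special_unitary :: 'n::finite cmat set)"
  shows "su_eqn_range \<subseteq> range (su_eqn_deriv p)"
proof
  fix w :: "'n cmat \<times> real" assume "w \<in> su_eqn_range"
  then obtain A r where "w = (A, r)" "ct A = A" by (auto simp: su_eqn_range_def)
  then show "w \<in> range (su_eqn_deriv p)" using su_eqn_deriv_surj[OF p] by (metis rangeI)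
qed

lemma su_eqn_deriv_eq_0_iff:
  assumes p: "p \<in> special_unitary"
  shows "su_eqn_deriv p V = 0 \<longleftrightarrow> ct p ** V \<in> su"
proof -
  have "ct V ** p = ct (ct p ** V)" by (simp add: ct_mult)
  then have "su_eqn_deriv p V = 0 \<longleftrightarrow> ct (ct p ** V) = - (ct p ** V) \<and> Im (trace (ct p ** V)) = 0"
    by (auto simp: su_eqn_deriv_def zero_prod_def eq_neg_iff_add_eq_0)
  also have "\<dots> \<longleftrightarrow> ct p ** V \<in> su"
    using trace_skew[of "ct p ** V"] by (auto simp: su_def complex_eq_iff)
  finally show ?thesis .
qed

lemma tangent_space_special_unitary:
  assumes p: "p \<in> special_unitary"
  shows "tangent_space special_unitary p = {V. ct p ** V \<in> su}"
proof -
  have p': "p \<in> det_domain" "su_eqn p = 0" using p special_unitary_level_set by auto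
  show ?thesis
    unfolding special_unitary_level_set
      tangent_space_level_set[OF smooth_su_eqn subspace_su_eqn_range su_eqn_in_range p' has_derivative_su_eqn[OF p]
        su_eqn_range_surj[OF p]]
    using su_eqn_deriv_eq_0_iff[OF p] by simp
qed

lemma embedded_special_unitary:
  "embedded_submanifold (DIM('n::finite cmat) - dim (su_eqn_range :: ('n::finite cmat \<times> real) set))
     (special_unitary :: 'n cmat set)"
  unfolding special_unitary_level_set
  by (rule embedded_submanifold_level_set[OF smooth_su_eqn subspace_su_eqn_range su_eqn_in_range,
        where D = su_eqn_deriv])
     (auto intro: has_derivative_su_eqn su_eqn_range_surj[THEN subsetD] simp: special_unitary_level_set)

lemma subspace_tangent_special_unitary:
  assumes "p \<in> (special_unitary :: 'n::finite cmat set)"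
  shows "subspace (tangent_space special_unitary p)"
  using subspace_su unfolding tangent_space_special_unitary[OF assms] subspace_def
  by (auto simp: matrix_mult_simps)

text \<open>
  This is the derivative of \<open>q \<mapsto> q\<^sup>* Y q\<close>, which takes its values in \<open>su\<close>, along a curve with velocity \<open>v\<close>.
\<close>

lemma field_derivative_special_unitary:
  assumes p: "p \<in> special_unitary" and Y: "\<And>q. q \<in> special_unitary \<Longrightarrow> Y q \<in> tangent_space special_unitary q"
    and D: "(Y has_derivative D) (at p within special_unitary)"
    and v: "v \<in> tangent_space special_unitary p"
  shows "ct v ** Y p + ct p ** D v \<in> su"
proof -
  obtain c where c: "c 0 = p" "\<And>t::real. c t \<in> special_unitary" "(c has_vector_derivative v) (at 0)"
    using v unfolding tangent_space_def by blast
  have dY: "((\<lambda>t. Y (c t)) has_vector_derivative D v) (at 0)"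
    by (rule has_vector_derivative_along_curve[OF D c])
  have "((\<lambda>t. ct (c t) ** Y (c t)) has_vector_derivative (ct (c 0) ** D v + ct v ** Y (c 0))) (at 0)"
    by (rule bounded_bilinear.has_vector_derivative[OF bounded_bilinear_matrix_mult
          bounded_linear.has_vector_derivative[OF bounded_linear_ct c(3)] dY])
  moreover have "ct (c t) ** Y (c t) \<in> su" for t
    using Y[OF c(2)] tangent_space_special_unitary[OF c(2)] by blast
  ultimately have "ct (c 0) ** D v + ct v ** Y (c 0) \<in> su"
    by (rule has_vector_derivative_in_subspace[OF subspace_su])
  then show ?thesis using c(1) by (simp add: add.commute)
qed

definition su_tangent_proj :: "'n::finite cmat \<Rightarrow> 'n cmat \<Rightarrow> 'n cmat" where
  "su_tangent_proj q w = q ** su_proj (ct q ** w)"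

text \<open>
  Write \<open>X p = p \<xi>\<close> and \<open>Y p = p \<eta>\<close>. The ordinary derivatives of \<open>Y\<close> along \<open>X\<close> and of \<open>X\<close> along \<open>Y\<close> fail to be
  tangent only by \<open>p \<xi> \<eta>\<close> and \<open>p \<eta> \<xi>\<close>, and the commutator of \<open>\<xi>\<close> and \<open>\<eta>\<close> is again in \<open>su\<close>.
\<close>

lemma lie_bracket_special_unitary:
  assumes X: "vector_field special_unitary X" and Y: "vector_field special_unitary Y" and p: "p \<in> special_unitary"
  shows "lie_bracket special_unitary X Y p \<in> tangent_space special_unitary p"
proof -
  obtain D where D: "(Y has_derivative D) (at p within special_unitary)"
    using smooth_map_on_has_derivative Y p unfolding vector_field_def by blast
  obtain D' where D': "(X has_derivative D') (at p within special_unitary)"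
    using smooth_map_on_has_derivative X p unfolding vector_field_def by blast
  have XT: "X q \<in> tangent_space special_unitary q" and YT: "Y q \<in> tangent_space special_unitary q"
    if "q \<in> special_unitary" for q using X Y that unfolding vector_field_def by auto
  define \<xi> where "\<xi> = ct p ** X p"
  define \<eta> where "\<eta> = ct p ** Y p"
  have su: "\<xi> \<in> su" "\<eta> \<in> su" unfolding \<xi>_def \<eta>_def
    using XT[OF p] YT[OF p] tangent_space_special_unitary[OF p] by auto
  have eqs: "X p = p ** \<xi>" "Y p = p ** \<eta>" unfolding \<xi>_def \<eta>_def by (simp_all add: mult_ct_cancel[OF p])
  have 1: "ct (X p) ** Y p + ct p ** D (X p) \<in> su"
    by (rule field_derivative_special_unitary[OF p YT D XT[OF p]])
  have 2: "ct (Y p) ** X p + ct p ** D' (Y p) \<in> su"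
    by (rule field_derivative_special_unitary[OF p XT D' YT[OF p]])
  have "ct (X p) ** Y p = - (\<xi> ** \<eta>)" "ct (Y p) ** X p = - (\<eta> ** \<xi>)"
    using su unfolding eqs ct_mult su_def
    by (simp_all add: matrix_mul_assoc[symmetric] ct_mult_cancel[OF p] matrix_mult_simps)
  then have "(ct p ** D (X p) - \<xi> ** \<eta>) - (ct p ** D' (Y p) - \<eta> ** \<xi>) \<in> su"
    using subspace_diff[OF subspace_su 1 2] by simp
  moreover have "\<xi> ** \<eta> - \<eta> ** \<xi> \<in> su"
    using su unfolding su_def by (simp add: ct_diff ct_mult matrix_mult_simps trace_simps trace_mul_sym[of \<xi>])
  ultimately have "((ct p ** D (X p) - \<xi> ** \<eta>) - (ct p ** D' (Y p) - \<eta> ** \<xi>)) + (\<xi> ** \<eta> - \<eta> ** \<xi>) \<in> su"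
    by (rule subspace_add[OF subspace_su])
  then have "ct p ** (D (X p) - D' (Y p)) \<in> su" by (simp add: matrix_mult_simps)
  then show ?thesis
    unfolding lie_bracket_def tangential_derivative_eq[OF D XT[OF p]] tangential_derivative_eq[OF D' YT[OF p]]
      tangent_space_special_unitary[OF p] by simp
qed

interpretation SU: tangent_projection "special_unitary :: 'n::finite cmat set" su_tangent_proj
proof (rule tangent_projection.intro)
  show "subspace (tangent_space special_unitary p)" if "p \<in> special_unitary" for p :: "'n cmat"
    using subspace_tangent_special_unitary that .
  show "linear (su_tangent_proj q)" for q :: "'n cmat"
    unfolding su_tangent_proj_def[abs_def]
    by (intro bounded_linear.linear bounded_linear_compose[OF bounded_linear_mult_left]
        bounded_linear_compose[OF bounded_linear_su_proj] bounded_linear_mult_left)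
  show "Ck_on k UNIV (\<lambda>q. su_tangent_proj q w)" for k and w :: "'n cmat"
    unfolding su_tangent_proj_def
    by (intro Ck_on_matrix_mult Ck_on_linear_compose[OF open_UNIV bounded_linear_su_proj] Ck_on_ct
        Ck_on_ident Ck_on_const open_UNIV)
  show "su_tangent_proj p w \<in> tangent_space special_unitary p" if "p \<in> special_unitary" for p w :: "'n cmat"
    by (simp add: tangent_space_special_unitary[OF that] su_tangent_proj_def ct_mult_cancel[OF that] su_proj_in_su)
  show "(w - su_tangent_proj p w) \<bullet> v = 0"
    if "p \<in> special_unitary" "v \<in> tangent_space special_unitary p" for p v w :: "'n cmat"
  proof -
    define Y where "Y = ct p ** v"
    have Y: "Y \<in> su" using that by (simp add: Y_def tangent_space_special_unitary)
    have v: "v = p ** Y" by (simp add: Y_def mult_ct_cancel[OF that(1)])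
    have "(w - su_tangent_proj p w) \<bullet> v = (p ** (ct p ** w - su_proj (ct p ** w))) \<bullet> v"
      by (simp add: matrix_mult_simps mult_ct_cancel[OF that(1)] su_tangent_proj_def)
    also have "\<dots> = (ct p ** w - su_proj (ct p ** w)) \<bullet> Y"
      by (simp add: inner_mult_left Y_def)
    also have "\<dots> = 0" by (rule su_proj_orthogonal[OF Y])
    finally show ?thesis .
  qed
  show "lie_bracket special_unitary X Y p \<in> tangent_space special_unitary p"
    if "vector_field special_unitary X" "vector_field special_unitary Y" "p \<in> special_unitary" for X Y and p :: "'n cmat"
    using lie_bracket_special_unitary that .
qed

lemma compact_special_unitary: "compact (special_unitary :: 'n::finite cmat set)"
proof -
  have "norm z \<le> sqrt CARD('n)" if "z \<in> special_unitary" for z :: "'n cmat"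
  proof -
    have "z \<bullet> z = CARD('n)" by (simp add: inner_eq_trace special_unitaryD[OF that] trace_simps)
    then show ?thesis by (simp add: norm_eq_sqrt_inner)
  qed
  then have "bounded (special_unitary :: 'n cmat set)" unfolding bounded_iff by blast
  moreover have "closed (special_unitary :: 'n cmat set)"
  proof -
    have "continuous_on UNIV (\<lambda>z::'n cmat. z ** ct z)"
      by (intro Ck_on_imp_continuous_on[of 0] Ck_on_matrix_mult Ck_on_ct Ck_on_ident open_UNIV)
    moreover have "continuous_on UNIV (det :: 'n cmat \<Rightarrow> complex)"
      by (rule Ck_on_imp_continuous_on[OF Ck_on_det])
    ultimately show ?thesis unfolding special_unitary_def
      by (intro closed_Collect_conj closed_Collect_eq continuous_on_const)
  qed
  ultimately show ?thesis by (simp add: compact_eq_bounded_closed)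
qed

section \<open>Eigenvectors of a matrix with simple spectrum\<close>

text \<open>
  Applying \<open>K - d\<close> to a vanishing combination removes the term of the eigenvalue \<open>d\<close> and multiplies the others
  by the nonzero numbers \<open>c - d\<close>.
\<close>

lemma eigenvector_combination_eq_0:
  fixes K :: "complex^'n^'n"
  assumes "finite C" "\<And>c. c \<in> C \<Longrightarrow> K *v v c = c *s v c" "\<And>c. c \<in> C \<Longrightarrow> v c \<noteq> 0"
    and "(\<Sum>c\<in>C. \<alpha> c *s v c) = 0" "c \<in> C"
  shows "\<alpha> c = 0"
  using assms
proof (induction C arbitrary: \<alpha> c rule: finite_induct)
  case empty
  then show ?case by simp
next
  case (insert d C)
  have sum: "\<alpha> d *s v d + (\<Sum>c\<in>C. \<alpha> c *s v c) = 0" using insert by simp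
  have "K *v (\<alpha> d *s v d + (\<Sum>c\<in>C. \<alpha> c *s v c)) = \<alpha> d *s (d *s v d) + (\<Sum>c\<in>C. \<alpha> c *s (c *s v c))"
    using insert.prems(1)
    by (simp add: vec.linear_add[OF matrix_vector_mul_linear_gen] vec.linear_sum[OF matrix_vector_mul_linear_gen] vec.linear_scale[OF matrix_vector_mul_linear_gen] cong: sum.cong)
  then have K: "\<alpha> d *s (d *s v d) + (\<Sum>c\<in>C. \<alpha> c *s (c *s v c)) = 0" using sum by simp
  have "(\<Sum>c\<in>C. (\<alpha> c * (c - d)) *s v c) =
      (\<Sum>c\<in>C. \<alpha> c *s (c *s v c)) - d *s (\<Sum>c\<in>C. \<alpha> c *s v c)"
    by (simp add: vec.scale_sum_right sum_subtractf[symmetric] vec_eq_iff algebra_simps)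
  also have "\<dots> = (\<alpha> d *s (d *s v d) + (\<Sum>c\<in>C. \<alpha> c *s (c *s v c))) -
      d *s (\<alpha> d *s v d + (\<Sum>c\<in>C. \<alpha> c *s v c))"
    by (simp add: vec.scale_right_distrib mult.commute)
  also have "\<dots> = 0" using sum K by simp
  finally have z: "\<alpha> c * (c - d) = 0" if "c \<in> C" for c
    using insert.IH[of "\<lambda>c. \<alpha> c * (c - d)" c] insert.prems(1,2) that by auto
  have zero: "\<alpha> c = 0" if "c \<in> C" for c using z[OF that] insert.hyps(2) that by auto
  then have "\<alpha> d *s v d = 0" using sum by simp
  then have "\<alpha> d = 0" using insert.prems(2)[of d] by simp
  then show ?case using zero insert.prems(4) by auto
qed

text \<open>
  The functional \<open>h u = y\<^sup>* u\<close> satisfies \<open>h (K u) = c * h u\<close>. It therefore vanishes on the eigenvectors for the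
  other eigenvalues, and by assumption on \<open>x\<close>. With as many eigenvalues as dimensions these
  vectors form a basis.
\<close>

lemma orthogonal_eigenvectors_simple_spectrum:
  fixes K :: "complex^'n^'n"
  assumes card: "card (eigenvalues K) = CARD('n)"
    and x: "K *v x = c *s x" "x \<noteq> 0" and y: "ct K *v y = cnj c *s y"
    and orth: "(\<Sum>i\<in>UNIV. cnj (y $ i) * x $ i) = 0"
  shows "y = 0"
proof -
  define h where "h u = (\<Sum>i\<in>UNIV. cnj (y $ i) * u $ i)" for u
  have "card (eigenvalues K) > 0" using card by simp
  then have fin: "finite (eigenvalues K)" using card_ge_0_finite by blast
  have "\<forall>d\<in>eigenvalues K. \<exists>u. u \<noteq> 0 \<and> K *v u = d *s u" by (simp add: eigenvalues_def)
  then obtain v0 where v0: "\<forall>d\<in>eigenvalues K. v0 d \<noteq> 0 \<and> K *v v0 d = d *s v0 d" by metis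
  define v where "v = v0(c := x)"
  have v: "v d \<noteq> 0" "K *v v d = d *s v d" if "d \<in> eigenvalues K" for d
    using v0 that x by (auto simp: v_def)
  have inj: "inj_on v (eigenvalues K)"
  proof (rule inj_onI)
    fix d d' assume d: "d \<in> eigenvalues K" "d' \<in> eigenvalues K" "v d = v d'"
    then have "d *s v d = d' *s v d" using v(2)[OF d(1)] v(2)[OF d(2)] by metis
    then show "d = d'" using v(1)[OF d(1)] vec.scale_right_imp_eq by blast
  qed
  have indep: "vec.independent (v ` eigenvalues K)"
  proof
    assume "vec.dependent (v ` eigenvalues K)"
    then obtain u where u: "\<exists>w\<in>v ` eigenvalues K. u w \<noteq> 0" "(\<Sum>w\<in>v ` eigenvalues K. u w *s w) = 0"
      using vec.dependent_finite[OF finite_imageI[OF fin]] by blast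
    have "(\<Sum>d\<in>eigenvalues K. u (v d) *s v d) = 0" using u(2) by (simp add: sum.reindex[OF inj])
    then have "u (v d) = 0" if "d \<in> eigenvalues K" for d
      using eigenvector_combination_eq_0[of "eigenvalues K" K v "\<lambda>d. u (v d)", OF fin v(2,1)] that by blast
    then show False using u(1) by blast
  qed
  have "UNIV \<subseteq> vec.span (v ` eigenvalues K)"
    by (rule vec.card_ge_dim_independent[OF subset_UNIV indep])
       (simp add: card_image[OF inj] card card_cart_basis)
  moreover have "vec.span (v ` eigenvalues K) \<subseteq> {u. h u = 0}"
  proof (rule vec.span_minimal)
    show "vec.subspace {u. h u = 0}"
      unfolding vec.subspace_def h_def by (simp add: distrib_left sum.distrib mult.left_commute flip: sum_distrib_left)
    have hK: "h (K *v u) = c * h u" for u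
    proof -
      have "h (K *v u) = (\<Sum>i\<in>UNIV. \<Sum>j\<in>UNIV. cnj (y $ i) * K $ i $ j * u $ j)"
        by (simp add: h_def matrix_vector_mult_def sum_distrib_left mult.assoc)
      also have "\<dots> = (\<Sum>j\<in>UNIV. cnj ((ct K *v y) $ j) * u $ j)"
        by (subst sum.swap) (simp add: matrix_vector_mult_def sum_distrib_left mult.commute mult.left_commute)
      also have "\<dots> = c * h u" by (simp add: y h_def sum_distrib_left mult.assoc)
      finally show ?thesis .
    qed
    show "v ` eigenvalues K \<subseteq> {u. h u = 0}"
    proof clarify
      fix d assume d: "d \<in> eigenvalues K"
      show "h (v d) = 0"
      proof (cases "d = c")
        case True
        then show ?thesis using orth by (simp add: v_def h_def)
      next
        case False
        have "c * h (v d) = h (d *s v d)" using hK[of "v d"] v(2)[OF d] by simp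
        also have "\<dots> = d * h (v d)" by (simp add: h_def sum_distrib_left mult.left_commute)
        finally show ?thesis using False by auto
      qed
    qed
  qed
  ultimately have "h y = 0" by blast
  then have "(\<Sum>i\<in>UNIV. (cmod (y $ i))\<^sup>2) = 0"
  proof -
    have "of_real (\<Sum>i\<in>UNIV. (cmod (y $ i))\<^sup>2) = h y"
      by (simp add: h_def complex_norm_square mult.commute del: of_real_power)
    then show ?thesis using \<open>h y = 0\<close> by (metis of_real_eq_0_iff)
  qed
  then show "y = 0" by (simp add: sum_nonneg_eq_0_iff vec_eq_iff)
qed

section \<open>Matrix algebra around an off-diagonal entry\<close>

definition unit_mat :: "'n \<Rightarrow> 'n \<Rightarrow> 'n::finite cmat" where
  "unit_mat a b = (\<chi> i j. if i = a \<and> j = b then 1 else 0)"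

lemma unit_mat_nth: "unit_mat a b $ i $ j = (if i = a \<and> j = b then 1 else 0)"
  by (simp add: unit_mat_def)

lemma ct_unit_mat: "ct (unit_mat a b) = unit_mat b a"
  by (simp add: vec_eq_iff unit_mat_nth)

lemma mult_unit_mat_nth: "((X :: 'n::finite cmat) ** unit_mat a b) $ i $ j = (if j = b then X $ i $ a else 0)"
proof -
  have "(X ** unit_mat a b) $ i $ j = (\<Sum>k\<in>UNIV. if k = a then (if j = b then X $ i $ k else 0) else 0)"
    unfolding mult_nth unit_mat_nth by (rule sum.cong) auto
  then show ?thesis by simp
qed

lemma unit_mat_mult_nth: "(unit_mat a b ** (X :: 'n::finite cmat)) $ i $ j = (if i = a then X $ b $ j else 0)"
proof -
  have "(unit_mat a b ** X) $ i $ j = (\<Sum>k\<in>UNIV. if k = b then (if i = a then X $ k $ j else 0) else 0)"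
    unfolding mult_nth unit_mat_nth by (rule sum.cong) auto
  then show ?thesis by simp
qed

lemma mult_unit_mat_mult_nth: "((X :: 'n::finite cmat) ** (unit_mat a b ** (Y :: 'n cmat))) $ i $ j = X $ i $ a * Y $ b $ j"
proof -
  have "(X ** (unit_mat a b ** Y)) $ i $ j = (\<Sum>k\<in>UNIV. if k = a then X $ i $ k * Y $ b $ j else 0)"
    unfolding mult_nth[of X] unit_mat_mult_nth by (rule sum.cong) auto
  then show ?thesis by simp
qed

lemma trace_unit_mat_mult: "trace (unit_mat b a ** X) = X $ a $ b"
  by (simp add: trace_def unit_mat_mult_nth)

text \<open>
  The complex gradient of the entry \<open>a, b\<close> of the commutator \<open>B Y - Y B\<close>, as a function of \<open>Y\<close>, for the Hermitian
  form \<open>trace (P\<^sup>* Y)\<close>.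
\<close>

definition grad_mat :: "'n \<Rightarrow> 'n \<Rightarrow> 'n::finite cmat \<Rightarrow> 'n cmat" where
  "grad_mat a b B = ct B ** unit_mat a b - unit_mat a b ** ct B"

lemma grad_mat_nth:
  "grad_mat a b B $ i $ j = (if j = b then cnj (B $ a $ i) else 0) - (if i = a then cnj (B $ j $ b) else 0)"
  by (simp add: grad_mat_def mult_unit_mat_nth unit_mat_mult_nth)

lemma ct_grad_mat: "ct (grad_mat a b B) = unit_mat b a ** B - B ** unit_mat b a"
  by (simp add: grad_mat_def ct_diff ct_mult ct_unit_mat)

lemma trace_ct_grad_mat:
  "trace (ct (grad_mat a b B) ** Y) = (B ** Y - Y ** B) $ a $ b"
proof -
  have "trace (ct (grad_mat a b B) ** Y) = trace (unit_mat b a ** (B ** Y)) - trace ((B ** unit_mat b a) ** Y)"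
    by (simp add: ct_grad_mat matrix_mult_simps trace_simps matrix_mul_assoc)
  also have "trace ((B ** unit_mat b a) ** Y) = trace (unit_mat b a ** (Y ** B))"
    by (metis matrix_mul_assoc trace_mul_sym)
  finally show ?thesis by (simp add: trace_unit_mat_mult)
qed

lemma mult_mat_mult: "(A :: 'n::finite cmat) ** (mat c ** X) = mat c ** (A ** (X :: 'n::finite cmat))"
  by (simp add: vec_eq_iff mult_nth[of A] mat_mult_nth sum_distrib_left mult.left_commute)

lemma ct_mat_mult: "ct (mat c ** X) = mat (cnj c) ** ct (X :: 'n::finite cmat)"
  by (simp add: vec_eq_iff mat_mult_nth)

lemma trace_grad_mat: "trace (grad_mat a b B) = 0"
  by (simp add: grad_mat_def trace_simps trace_mul_sym[of "ct B"])

text \<open>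
  For trace-free \<open>P\<close>, the element of \<open>su\<close> that represents, up to the factor two, the real functional
  \<open>Y \<mapsto> Re (cnj \<zeta> * trace (P\<^sup>* Y))\<close>. For \<open>\<zeta> = 1\<close> and \<open>\<zeta> = \<i>\<close> this gives the gradients of the real and the
  imaginary part.
\<close>

definition normal_mat :: "'n::finite cmat \<Rightarrow> complex \<Rightarrow> 'n cmat" where
  "normal_mat P \<zeta> = mat \<zeta> ** P - mat (cnj \<zeta>) ** ct P"

lemma normal_mat_su: "trace P = 0 \<Longrightarrow> normal_mat P \<zeta> \<in> su"
  by (simp add: su_def normal_mat_def ct_diff ct_mat_mult trace_simps trace_mat_mult)

lemma trace_ct_mult_self: "trace (ct P ** P) = of_real (P \<bullet> (P :: 'n::finite cmat))"
proof -
  have "cnj (trace (ct P ** P)) = trace (ct P ** P)"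
    using trace_simps(7)[of "ct P ** P"] by (simp add: ct_mult)
  then have "Im (trace (ct P ** P)) = 0" by (simp add: complex_eq_iff)
  moreover have "Re (trace (ct P ** P)) = P \<bullet> P" by (simp add: inner_eq_trace trace_mul_sym[of P])
  ultimately show ?thesis by (simp add: complex_eq_iff)
qed

lemma inner_normal_mat:
  assumes Y: "Y \<in> su" and P: "trace P = 0"
  shows "Y \<bullet> normal_mat P \<zeta> = 2 * Re (cnj \<zeta> * trace (ct P ** Y))"
proof -
  have N: "ct (normal_mat P \<zeta>) = - normal_mat P \<zeta>" using normal_mat_su[OF P] by (simp add: su_def)
  have 1: "trace (Y ** P) = - cnj (trace (ct P ** Y))"
  proof -
    have "cnj (trace (ct P ** Y)) = trace (ct Y ** P)"
      using trace_simps(7)[of "ct P ** Y"] by (simp add: ct_mult)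
    then show ?thesis using Y by (simp add: su_def matrix_mult_simps trace_simps)
  qed
  have "Y \<bullet> normal_mat P \<zeta> = - Re (trace (Y ** normal_mat P \<zeta>))"
    by (simp add: inner_eq_trace N matrix_mult_simps trace_simps)
  also have "trace (Y ** normal_mat P \<zeta>) = \<zeta> * trace (Y ** P) - cnj \<zeta> * trace (ct P ** Y)"
    by (simp add: normal_mat_def matrix_mult_simps mult_mat_mult trace_simps trace_mat_mult trace_mul_sym[of Y "ct P"])
  finally show ?thesis unfolding 1 by simp
qed

text \<open>
  The identity \<open>tr (P\<^sup>* P\<^sup>*) = 0\<close> makes the gradients of the real and of the imaginary part orthogonal and
  equally long. It holds at zeros of \<open>B\<^sub>a\<^sub>b\<close>, since the left-hand side is \<open>2 * B\<^sub>a\<^sub>b * B\<^sub>a\<^sub>b\<close>.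
\<close>

lemma trace_ct_grad_mat_sq:
  assumes ab: "a \<noteq> b" and B: "B $ a $ b = 0"
  shows "trace (ct (grad_mat a b B) ** ct (grad_mat a b B)) = 0"
proof -
  show ?thesis
    unfolding trace_ct_grad_mat unfolding ct_grad_mat
    using ab B
    by (simp add: matrix_mult_simps matrix_mul_assoc[symmetric] mult_unit_mat_mult_nth unit_mat_mult_nth)
       (simp add: matrix_mul_assoc mult_unit_mat_nth)
qed

lemma trace_ct_grad_mat_normal_mat:
  assumes ab: "a \<noteq> b" and B: "B $ a $ b = 0"
  shows "trace (ct (grad_mat a b B) ** normal_mat (grad_mat a b B) \<zeta>) =
    \<zeta> * of_real (grad_mat a b B \<bullet> grad_mat a b B)"
  by (simp add: normal_mat_def matrix_mult_simps mult_mat_mult trace_simps trace_mat_mult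
      trace_ct_grad_mat_sq[OF assms] trace_ct_mult_self)

text \<open>
  The second derivative at \<open>t = 0\<close> of \<open>exp (- t Y) B exp (t Y)\<close>.
\<close>

definition double_comm :: "'n::finite cmat \<Rightarrow> 'n cmat \<Rightarrow> 'n cmat" where
  "double_comm B Y = (B ** Y - Y ** B) ** Y - Y ** (B ** Y - Y ** B)"

lemma mat_mult_mat_mult:
  "(mat c ** (A :: 'n::finite cmat)) ** (mat d ** (X :: 'n cmat)) = mat (c * d) ** (A ** X)"
  by (simp add: vec_eq_iff mult_nth[of "mat c ** A"] mult_nth[of A] mat_mult_nth sum_distrib_left mult_ac)

lemma double_comm_mat_mult:
  "double_comm B (mat c ** Y) = mat (c * c) ** double_comm B (Y :: 'n::finite cmat)"
proof -
  have "B ** (mat c ** Y) - (mat c ** Y) ** B = mat c ** (B ** Y - Y ** B)"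
    by (simp only: mult_mat_mult[of B] matrix_mul_assoc[symmetric] matrix_mult_simps)
  then show ?thesis
    unfolding double_comm_def by (simp only: mat_mult_mat_mult matrix_mult_simps)
qed

text \<open>
  The two normal directions are \<open>P - P\<^sup>*\<close> and \<open>\<i> (P + P\<^sup>*)\<close>, so by polarization the sum is
  \<open>- 2 ([[B, P], P\<^sup>*] + [[B, P\<^sup>*], P])\<close>. The entry \<open>a, b\<close> of a product that begins or ends with \<open>P\<^sup>*\<close> vanishes.
  The two remaining products \<open>B P\<^sup>* P\<close> and \<open>P P\<^sup>* B\<close> have opposite entries.
\<close>

lemma double_comm_normal_mats:
  fixes B :: "'n::finite cmat"
  assumes ab: "a \<noteq> b" and B: "B $ a $ b = 0"
  defines "P \<equiv> grad_mat a b B"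
  shows "(double_comm B (normal_mat P 1) + double_comm B (normal_mat P \<i>)) $ a $ b = 0"
proof -
  define P' where "P' = ct P"
  have N1: "normal_mat P 1 = P - P'" by (simp add: normal_mat_def P'_def)
  have Ni: "normal_mat P \<i> = mat \<i> ** (P + P')"
    by (simp add: normal_mat_def P'_def vec_eq_iff mat_mult_nth algebra_simps)
  have "double_comm B (normal_mat P \<i>) = - double_comm B (P + P')"
    unfolding Ni double_comm_mat_mult by (simp add: vec_eq_iff mat_mult_nth)
  then have eq: "double_comm B (normal_mat P 1) + double_comm B (normal_mat P \<i>) =
      double_comm B (P - P') - double_comm B (P + P')" by (simp add: N1)
  define Z where "Z = ((B ** P - P ** B) ** P' - P' ** (B ** P - P ** B)) +
      ((B ** P' - P' ** B) ** P - P ** (B ** P' - P' ** B))"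
  have polar: "double_comm B (P - P') - double_comm B (P + P') = - (Z + Z)"
    unfolding double_comm_def Z_def by (simp add: matrix_mult_simps)
  have row: "(P' ** X) $ a $ b = 0" for X
    using ab B by (simp add: P'_def P_def ct_grad_mat matrix_mult_simps matrix_mul_assoc[symmetric]
        mult_unit_mat_mult_nth unit_mat_mult_nth)
  have col: "(X ** P') $ a $ b = 0" for X
    using ab B by (simp add: P'_def P_def ct_grad_mat matrix_mult_simps mult_unit_mat_mult_nth)
      (simp add: matrix_mul_assoc mult_unit_mat_nth)
  have BP: "(B ** P') $ a $ j = (if j = a then - (B ** B) $ a $ b else 0)" for j
    using B by (simp add: P'_def P_def ct_grad_mat matrix_mult_simps mult_unit_mat_mult_nth)
      (simp add: matrix_mul_assoc mult_unit_mat_nth)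
  have PB: "(P' ** B) $ j $ b = (if j = b then (B ** B) $ a $ b else 0)" for j
    using B by (simp add: P'_def P_def ct_grad_mat matrix_mult_simps matrix_mul_assoc[symmetric] mult_unit_mat_mult_nth unit_mat_mult_nth)
  have "((B ** P') ** P) $ a $ b = - (B ** B) $ a $ b * P $ a $ b"
    by (simp add: mult_nth[of "B ** P'"] BP if_distrib if_distribR cong: if_cong)
  moreover have "(P ** (P' ** B)) $ a $ b = (B ** B) $ a $ b * P $ a $ b"
    by (simp add: mult_nth[of P] PB if_distrib cong: if_cong)
  moreover have "(P' ** B ** P) $ a $ b = 0" "(P ** (B ** P')) $ a $ b = 0"
    using row[of "B ** P"] col[of "P ** B"] by (simp_all add: matrix_mul_assoc)
  ultimately have "Z $ a $ b = 0"
    using row[of "B ** P - P ** B"] col[of "B ** P - P ** B"]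
    unfolding Z_def by (simp add: matrix_mult_simps)
  then show ?thesis unfolding eq polar by simp
qed

section \<open>The trace over a horizontal space\<close>

lemma inner_unit_mat: "unit_mat k l \<bullet> X = Re (X $ k $ l)"
  by (simp add: inner_eq_trace trace_unit_mat_mult)

lemma inner_i_unit_mat: "(mat \<i> ** unit_mat k l) \<bullet> X = Im (X $ k $ l)"
  by (simp add: inner_eq_trace matrix_mul_assoc[symmetric] trace_mat_mult trace_unit_mat_mult)

lemma su_proj_nth:
  "su_proj (U :: 'n::finite cmat) $ i $ j =
    (U $ i $ j - cnj (U $ j $ i)) / 2 - (if i = j then \<i> * of_real (Im (trace U)) / of_nat CARD('n) else 0)"
  by (simp add: su_proj_def mat_nth scaleR_conv_of_real[where 'a = complex])

lemma su_proj_unit_mats_nth: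
  fixes k l i j :: "'n::finite"
  shows "su_proj (unit_mat k l) $ i $ j + \<i> * su_proj (mat \<i> ** unit_mat k l) $ i $ j =
    (if k = l \<and> i = j then 1 / of_nat CARD('n) else 0) - (if k = j \<and> l = i then 1 else 0)"
proof -
  have t: "trace (unit_mat k l :: 'n cmat) = (if k = l then 1 else 0)"
    using trace_unit_mat_mult[of k l "mat 1"] by (auto simp: mat_nth)
  show ?thesis
    unfolding su_proj_nth[of "unit_mat k l"] su_proj_nth[of "mat \<i> ** unit_mat k l"] trace_mat_mult t mat_mult_nth unit_mat_nth
    by (cases "k = l"; cases "i = j"; cases "i = k"; cases "j = l") (simp_all add: complex_eq_iff)
qed

text \<open>
  The entry \<open>a, b\<close> of \<open>[[B, Y], Y]\<close> with the products \<open>Y\<^sub>k\<^sub>l Y\<^sub>i\<^sub>j\<close> replaced by a tensor \<open>\<tau>\<close>. It is linear in \<open>\<tau>\<close>, so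
  a trace over \<open>Y\<close> can be taken inside.
\<close>

definition comm_form :: "'n \<Rightarrow> 'n \<Rightarrow> 'n::finite cmat \<Rightarrow> ('n \<Rightarrow> 'n \<Rightarrow> 'n \<Rightarrow> 'n \<Rightarrow> complex) \<Rightarrow> complex" where
  "comm_form a b B \<tau> =
    (\<Sum>k\<in>UNIV. \<Sum>l\<in>UNIV. B $ a $ k * \<tau> k l l b - 2 * B $ k $ l * \<tau> a k l b + B $ l $ b * \<tau> a k k l)"

lemma comm_form_add: "comm_form a b B (\<lambda>k l i j. f k l i j + g k l i j) = comm_form a b B f + comm_form a b B g"
  by (simp add: comm_form_def sum.distrib[symmetric] algebra_simps)

lemma comm_form_scale: "comm_form a b B (\<lambda>k l i j. c * f k l i j) = c * comm_form a b B f"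
  by (simp add: comm_form_def sum_distrib_left algebra_simps)

lemma comm_form_sum:
  "comm_form a b B (\<lambda>k l i j. \<Sum>e\<in>E. f e k l i j) = (\<Sum>e\<in>E. comm_form a b B (f e))"
proof (induction E rule: infinite_finite_induct)
  case (insert e E)
  then show ?case using comm_form_add[of a b B "f e" "\<lambda>k l i j. \<Sum>e\<in>E. f e k l i j"] by simp
qed (simp_all add: comm_form_def)

lemma double_comm_nth:
  "double_comm B Y $ a $ b = comm_form a b B (\<lambda>k l i j. Y $ k $ l * Y $ i $ j)"
proof -
  have "double_comm B Y $ a $ b =
      (B ** (Y ** Y)) $ a $ b - 2 * (Y ** (B ** Y)) $ a $ b + (Y ** (Y ** B)) $ a $ b"
    by (simp add: double_comm_def matrix_mult_simps matrix_mul_assoc)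
  also have "\<dots> = comm_form a b B (\<lambda>k l i j. Y $ k $ l * Y $ i $ j)"
    by (simp add: comm_form_def mult_nth sum_distrib_left sum.distrib sum_subtractf mult_ac)
  finally show ?thesis .
qed

text \<open>
  The sum over \<open>E\<close> of the tensors \<open>e\<^sub>k\<^sub>l e\<^sub>i\<^sub>j\<close> is read off from the orthogonal projection onto the span of \<open>E\<close>,
  which is the projection onto \<open>su\<close> less the two normal directions. The first part is the Casimir tensor of \<open>su\<close>; it
  contracts to multiples of \<open>B\<^sub>a\<^sub>b = 0\<close>. The second part contracts to the sum that
  \<open>double_comm_normal_mats\<close> shows to be zero.
\<close>

lemma sum_double_comm_orthonormal:
  fixes B :: "'n::finite cmat"
  assumes ab: "a \<noteq> b" and B: "B $ a $ b = 0"
  defines "P \<equiv> grad_mat a b B"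
  assumes P0: "P \<noteq> 0" and E: "finite E" "span E = {Y\<in>su. trace (ct P ** Y) = 0}"
    "\<And>u v. u \<in> E \<Longrightarrow> v \<in> E \<Longrightarrow> u \<bullet> v = (if u = v then 1 else 0)"
  shows "(\<Sum>e\<in>E. double_comm B e $ a $ b) = 0"
proof -
  define N1 where "N1 = normal_mat P 1"
  define N2 where "N2 = normal_mat P \<i>"
  define \<nu> where "\<nu> = P \<bullet> P"
  have \<nu>: "\<nu> \<noteq> 0" using P0 by (simp add: \<nu>_def)
  have trP: "trace P = 0" by (simp add: P_def trace_grad_mat)
  have N: "N1 \<in> su" "N2 \<in> su" unfolding N1_def N2_def using normal_mat_su[OF trP] by auto
  define L where "L Y = trace (ct P ** Y)" for Y
  have LN: "L N1 = of_real \<nu>" "L N2 = \<i> * of_real \<nu>"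
    using trace_ct_grad_mat_normal_mat[OF ab B] unfolding L_def N1_def N2_def \<nu>_def P_def by auto
  have in1: "Y \<bullet> N1 = 2 * Re (L Y)" and in2: "Y \<bullet> N2 = 2 * Im (L Y)" if "Y \<in> su" for Y
    using inner_normal_mat[OF that trP] unfolding N1_def N2_def L_def by simp_all
  define proj where "proj C = su_proj C - (1 / (2 * \<nu>)) *\<^sub>R ((C \<bullet> N1) *\<^sub>R N1 + (C \<bullet> N2) *\<^sub>R N2)" for C
  have inN: "C \<bullet> N1 = 2 * Re (L (su_proj C))" "C \<bullet> N2 = 2 * Im (L (su_proj C))" for C
    using su_proj_orthogonal[OF N(1), of C] su_proj_orthogonal[OF N(2), of C]
      in1[OF su_proj_in_su, of C] in2[OF su_proj_in_su, of C] by (simp_all add: inner_diff_left)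
  have proj_su: "proj C \<in> su" for C
    unfolding proj_def by (intro subspace_diff subspace_add subspace_scale subspace_su su_proj_in_su N)
  have L_lin: "L (X - Y) = L X - L Y" "L (X + Y) = L X + L Y" "L (r *\<^sub>R X) = of_real r * L X" for X Y r
    by (simp_all add: L_def matrix_mult_simps trace_simps)
  have L_proj: "L (proj C) = 0" for C
  proof -
    have "L (proj C) = L (su_proj C) - of_real (1 / (2 * \<nu>)) *
        (of_real (2 * Re (L (su_proj C))) * of_real \<nu> + of_real (2 * Im (L (su_proj C))) * (\<i> * of_real \<nu>))"
      unfolding proj_def inN L_lin LN ..
    also have "\<dots> = L (su_proj C) - (of_real (Re (L (su_proj C))) + \<i> * of_real (Im (L (su_proj C))))"
    proof -
      have c: "of_real (1 / (2 * \<nu>)) * of_real \<nu> = (1 / 2 :: complex)" using \<nu> by simp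
      have h: "of_real (1 / (2 * \<nu>)) * (of_real (2 * x) * of_real \<nu> + of_real (2 * y) * (\<i> * of_real \<nu>)) =
          of_real x + \<i> * of_real y" for x y :: real
      proof -
        have "of_real (1 / (2 * \<nu>)) * (of_real (2 * x) * of_real \<nu> + of_real (2 * y) * (\<i> * of_real \<nu>)) =
            (of_real (1 / (2 * \<nu>)) * of_real \<nu>) * (2 * (of_real x + \<i> * of_real y))"
          by (simp only: of_real_mult of_real_numeral ring_distribs mult_ac)
        also have "\<dots> = of_real x + \<i> * of_real y" unfolding c by simp
        finally show ?thesis .
      qed
      show ?thesis unfolding h ..
    qed
    also have "\<dots> = 0" by (metis complex_eq diff_self)
    finally show ?thesis .
  qed
  have proj_span: "proj C \<in> span E" for C using proj_su L_proj unfolding E(2) L_def by simp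
  have E_su: "e \<in> su" "L e = 0" if "e \<in> E" for e
    using span_base[OF that] unfolding E(2) L_def by auto
  have proj_inner: "proj C \<bullet> e = C \<bullet> e" if "e \<in> E" for C e
  proof -
    have "N1 \<bullet> e = 0" "N2 \<bullet> e = 0"
      using in1[OF E_su(1)[OF that]] in2[OF E_su(1)[OF that]] E_su(2)[OF that] by (simp_all add: inner_commute)
    moreover have "su_proj C \<bullet> e = C \<bullet> e"
      using su_proj_orthogonal[OF E_su(1)[OF that], of C] by (simp add: inner_diff_left)
    ultimately show ?thesis by (simp add: proj_def inner_diff_left inner_add_left)
  qed
  have expand: "(\<Sum>e\<in>E. (C \<bullet> e) *\<^sub>R e) = proj C" for C
  proof -
    have "(\<Sum>e\<in>E. (proj C \<bullet> e) *\<^sub>R e) = proj C"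
      by (rule orthonormal_basis_expand[OF _ _ proj_span E(1)])
         (auto simp: pairwise_def orthogonal_def norm_eq_1 E(3))
    then show ?thesis using proj_inner by (simp cong: sum.cong)
  qed
  define \<tau> :: "'n \<Rightarrow> 'n \<Rightarrow> 'n \<Rightarrow> 'n \<Rightarrow> complex" where
    "\<tau> k l i j = (if k = l \<and> i = j then 1 / of_nat CARD('n) else 0) - (if k = j \<and> l = i then 1 else 0)" for k l i j
  \<comment> \<open>The entry \<open>e\<^sub>k\<^sub>l\<close> is put together from two real inner products, with \<open>E\<^sub>k\<^sub>l\<close> and with \<open>\<i> E\<^sub>k\<^sub>l\<close>.\<close>
  have casimir: "(\<Sum>e\<in>E. e $ k $ l * e $ i $ j) =
      \<tau> k l i j + (- 1 / of_real (2 * \<nu>)) * (N1 $ k $ l * N1 $ i $ j + N2 $ k $ l * N2 $ i $ j)" for k l i j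
  proof -
    have sp: "(\<Sum>e\<in>E. of_real (C \<bullet> e) * e $ i $ j) = proj C $ i $ j" for C
      unfolding expand[symmetric] by (simp add: scaleR_conv_of_real[where 'a = complex])
    have "(\<Sum>e\<in>E. e $ k $ l * e $ i $ j) =
        (\<Sum>e\<in>E. (of_real (unit_mat k l \<bullet> e) + \<i> * of_real ((mat \<i> ** unit_mat k l) \<bullet> e)) * e $ i $ j)"
      unfolding inner_unit_mat inner_i_unit_mat by (simp add: complex_eq[symmetric])
    also have "\<dots> = proj (unit_mat k l) $ i $ j + \<i> * proj (mat \<i> ** unit_mat k l) $ i $ j"
      by (simp add: sp[symmetric] algebra_simps sum.distrib sum_distrib_left)
    also have "\<dots> = (su_proj (unit_mat k l) $ i $ j + \<i> * su_proj (mat \<i> ** unit_mat k l) $ i $ j) -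
        (1 / of_real (2 * \<nu>)) * ((of_real (Re (N1 $ k $ l)) + \<i> * of_real (Im (N1 $ k $ l))) * N1 $ i $ j +
          (of_real (Re (N2 $ k $ l)) + \<i> * of_real (Im (N2 $ k $ l))) * N2 $ i $ j)"
      unfolding proj_def inner_unit_mat inner_i_unit_mat
      by (simp add: scaleR_conv_of_real[where 'a = complex] algebra_simps)
    finally show ?thesis
      unfolding su_proj_unit_mats_nth \<tau>_def[symmetric] complex_eq[symmetric] by simp
  qed
  have t1: "B $ a $ k * \<tau> k l l b = 0" for k l
    by (cases "k = b") (use B in \<open>auto simp: \<tau>_def\<close>)
  have t2: "B $ k $ l * \<tau> a k l b = 0" for k l
    by (cases "k = a \<and> l = b") (use B ab in \<open>auto simp: \<tau>_def\<close>)
  have t3: "B $ l $ b * \<tau> a k k l = 0" for k l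
    by (cases "l = a") (use B in \<open>auto simp: \<tau>_def\<close>)
  have "comm_form a b B \<tau> = 0"
    unfolding comm_form_def mult.assoc t1 t2 t3 by simp
  moreover have "(\<Sum>e\<in>E. double_comm B e $ a $ b) = comm_form a b B (\<lambda>k l i j. \<Sum>e\<in>E. e $ k $ l * e $ i $ j)"
    unfolding comm_form_sum double_comm_nth ..
  moreover have "comm_form a b B (\<lambda>k l i j. \<Sum>e\<in>E. e $ k $ l * e $ i $ j) =
      comm_form a b B \<tau> + (- 1 / of_real (2 * \<nu>)) * (double_comm B N1 $ a $ b + double_comm B N2 $ a $ b)"
    unfolding casimir comm_form_add comm_form_scale double_comm_nth ..
  moreover have "double_comm B N1 $ a $ b + double_comm B N2 $ a $ b = 0"
    using double_comm_normal_mats[OF ab B] unfolding N1_def N2_def P_def by simp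
  ultimately show ?thesis by simp
qed

section \<open>The zero set of a matrix coefficient\<close>

text \<open>
  The assumption \<open>regular\<close> says that a right and a left eigenvector of \<open>K\<close> for the same eigenvalue are never
  orthogonal. For a matrix with simple spectrum this holds, and it is what makes the zero set regular.
\<close>

locale matrix_coefficient =
  fixes K :: "complex^'n^'n" and a b :: 'n
  assumes ab: "a \<noteq> b"
    and regular: "K *v x = c *s x \<Longrightarrow> x \<noteq> 0 \<Longrightarrow> ct K *v y = cnj c *s y \<Longrightarrow>
      (\<Sum>i\<in>UNIV. cnj (y $ i) * x $ i) = 0 \<Longrightarrow> y = 0"
begin

definition conj_mat :: "'n cmat \<Rightarrow> 'n cmat" where
  "conj_mat z = ct z ** K ** z"

definition coeff :: "'n cmat \<Rightarrow> complex" where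
  "coeff z = conj_mat z $ a $ b"

definition zero_set :: "'n cmat set" where
  "zero_set = {z\<in>special_unitary. coeff z = 0}"

definition coeff_deriv :: "'n cmat \<Rightarrow> 'n cmat \<Rightarrow> complex" where
  "coeff_deriv p V = (ct V ** (K ** p) + ct p ** (K ** V)) $ a $ b"

definition grad :: "'n cmat \<Rightarrow> 'n cmat" where
  "grad p = grad_mat a b (conj_mat p)"

lemma zero_setD: "p \<in> zero_set \<Longrightarrow> p \<in> special_unitary" "p \<in> zero_set \<Longrightarrow> conj_mat p $ a $ b = 0"
  by (auto simp: zero_set_def coeff_def)

lemma Ck_on_conj_mat: "open U \<Longrightarrow> Ck_on k U conj_mat"
  unfolding conj_mat_def[abs_def]
  by (intro Ck_on_matrix_mult Ck_on_ct Ck_on_ident Ck_on_const)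

lemma Ck_on_coeff: "open U \<Longrightarrow> Ck_on k U coeff"
  unfolding coeff_def[abs_def]
  by (rule Ck_on_linear_compose[OF _ bounded_linear_nth Ck_on_conj_mat])

lemma linear_coeff_deriv: "linear (coeff_deriv p)"
  by (rule linearI) (simp_all add: coeff_deriv_def ct_add ct_scaleR matrix_mult_simps algebra_simps)

lemma has_derivative_coeff: "(coeff has_derivative coeff_deriv p) (at p)"
proof -
  have "((\<lambda>z. (ct z ** (K ** z)) $ a $ b) has_derivative (\<lambda>V. (ct p ** (K ** V) + ct V ** (K ** p)) $ a $ b)) (at p)"
    by (intro bounded_linear.has_derivative[OF bounded_linear_nth]
        bounded_bilinear.FDERIV[OF bounded_bilinear_matrix_mult]
        bounded_linear.has_derivative[OF bounded_linear_ct]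
        bounded_linear.has_derivative[OF bounded_linear_mult_left] has_derivative_ident)
  then show ?thesis
    by (simp add: coeff_def[abs_def] conj_mat_def coeff_deriv_def[abs_def] matrix_mul_assoc[symmetric] add.commute)
qed

lemma coeff_deriv_mult:
  assumes "p \<in> special_unitary" "Y \<in> su"
  shows "coeff_deriv p (p ** Y) = trace (ct (grad p) ** Y)"
proof -
  have "coeff_deriv p (p ** Y) = (ct Y ** conj_mat p + conj_mat p ** Y) $ a $ b"
    by (simp add: coeff_deriv_def conj_mat_def ct_mult matrix_mul_assoc)
  also have "\<dots> = trace (ct (grad p) ** Y)"
    using assms(2) by (simp add: su_def matrix_mult_simps grad_def trace_ct_grad_mat)
  finally show ?thesis .
qed

lemma grad_nonzero:
  assumes p: "p \<in> zero_set"
  shows "grad p \<noteq> 0"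
proof
  assume 0: "grad p = 0"
  have S: "p \<in> special_unitary" using p by (rule zero_setD)
  define B where "B = conj_mat p"
  have e: "(if j = b then cnj (B $ a $ i) else 0) - (if i = a then cnj (B $ j $ b) else 0) = 0" for i j
    using grad_mat_nth[of a b B i j] 0 by (simp add: grad_def B_def)
  have row: "B $ a $ i = 0" if "i \<noteq> a" for i using e[of b i] that by simp
  have col: "B $ j $ b = 0" if "j \<noteq> b" for j using e[of j a] that by simp
  have diag: "B $ a $ a = B $ b $ b" using e[of b a] by simp
  have KB: "K ** p = p ** B"
    by (simp add: B_def conj_mat_def matrix_mul_assoc special_unitaryD(1)[OF S])
  have KB': "ct K ** p = p ** ct B"
    by (simp add: B_def conj_mat_def ct_mult matrix_mul_assoc special_unitaryD(1)[OF S])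
  have x: "K *v column b p = B $ b $ b *s column b p"
  proof -
    have "(K *v column b p) $ i = (p ** B) $ i $ b" for i
      unfolding KB[symmetric] by (simp add: matrix_vector_mult_def column_def mult_nth)
    also have "(p ** B) $ i $ b = (\<Sum>k\<in>UNIV. if k = b then p $ i $ k * B $ b $ b else 0)" for i
      unfolding mult_nth by (rule sum.cong) (auto simp: col)
    finally show ?thesis by (simp add: vec_eq_iff column_def mult.commute)
  qed
  have y: "ct K *v column a p = cnj (B $ b $ b) *s column a p"
  proof -
    have "(ct K *v column a p) $ i = (p ** ct B) $ i $ a" for i
      unfolding KB'[symmetric] by (simp add: matrix_vector_mult_def column_def mult_nth)
    also have "(p ** ct B) $ i $ a = (\<Sum>k\<in>UNIV. if k = a then p $ i $ k * cnj (B $ b $ b) else 0)" for i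
      unfolding mult_nth by (rule sum.cong) (auto simp: row diag)
    finally show ?thesis by (simp add: vec_eq_iff column_def mult.commute)
  qed
  have ip: "(\<Sum>i\<in>UNIV. cnj (column c p $ i) * column d p $ i) = (mat 1 :: 'n cmat) $ c $ d" for c d
    unfolding special_unitaryD(2)[OF S, symmetric] by (simp add: mult_nth column_def)
  have "column b p \<noteq> 0" using ip[of b b] by (auto simp: mat_nth)
  then have "column a p = 0"
    by (rule regular[OF x _ y]) (use ip[of a b] ab in \<open>simp add: mat_nth\<close>)
  then show False using ip[of a a] by (simp add: mat_nth)
qed

definition eqns :: "'n cmat \<Rightarrow> ('n cmat \<times> real) \<times> complex" where
  "eqns z = (su_eqn z, coeff z)"

lemma zero_set_level_set: "zero_set = {z\<in>det_domain. eqns z = 0}"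
  unfolding zero_set_def special_unitary_level_set eqns_def by (auto simp: zero_prod_def)

lemma smooth_eqns: "smooth_on_open det_domain eqns"
  unfolding eqns_def[abs_def]
  by (intro smooth_on_openI[OF open_det_domain] Ck_on_Pair open_det_domain Ck_on_coeff
      smooth_on_openD(2)[OF smooth_su_eqn])

lemma subspace_eqns_range: "subspace ((su_eqn_range :: ('n cmat \<times> real) set) \<times> (UNIV :: complex set))"
  by (intro subspace_Times subspace_su_eqn_range subspace_UNIV)

lemma eqns_in_range: "eqns z \<in> su_eqn_range \<times> UNIV"
  by (simp add: eqns_def su_eqn_in_range)

lemma has_derivative_eqns:
  "p \<in> special_unitary \<Longrightarrow> (eqns has_derivative (\<lambda>V. (su_eqn_deriv p V, coeff_deriv p V))) (at p)"
  unfolding eqns_def[abs_def] by (intro has_derivative_Pair has_derivative_su_eqn has_derivative_coeff)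

lemma eqns_surj:
  assumes p: "p \<in> zero_set"
  shows "su_eqn_range \<times> UNIV \<subseteq> range (\<lambda>V. (su_eqn_deriv p V, coeff_deriv p V))"
proof
  fix w assume "w \<in> (su_eqn_range :: ('n cmat \<times> real) set) \<times> (UNIV :: complex set)"
  then obtain u c where w: "w = (u, c)" "u \<in> su_eqn_range" by auto
  have S: "p \<in> special_unitary" using p by (rule zero_setD)
  obtain V0 where V0: "su_eqn_deriv p V0 = u" using su_eqn_range_surj[OF S] w(2) by blast
  define \<nu> where "\<nu> = grad p \<bullet> grad p"
  have \<nu>: "\<nu> \<noteq> 0" using grad_nonzero[OF p] by (simp add: \<nu>_def)
  \<comment> \<open>A multiple of the gradient of \<open>coeff\<close>, tangent to the group, corrects the last component only.\<close>
  define \<zeta> where "\<zeta> = (c - coeff_deriv p V0) / of_real \<nu>"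
  define N where "N = normal_mat (grad p) \<zeta>"
  have N: "N \<in> su" unfolding N_def grad_def by (rule normal_mat_su[OF trace_grad_mat])
  have "coeff_deriv p (p ** N) = trace (ct (grad p) ** N)" by (rule coeff_deriv_mult[OF S N])
  also have "\<dots> = \<zeta> * of_real \<nu>"
    unfolding N_def \<nu>_def grad_def
    by (rule trace_ct_grad_mat_normal_mat[OF ab zero_setD(2)[OF p]])
  finally have "coeff_deriv p (p ** N) = \<zeta> * of_real \<nu>" .
  then have 1: "coeff_deriv p (V0 + p ** N) = c"
    using \<nu> by (simp add: linear_add[OF linear_coeff_deriv] \<zeta>_def)
  have "su_eqn_deriv p (p ** N) = 0"
    using su_eqn_deriv_eq_0_iff[OF S] N by (simp add: ct_mult_cancel[OF S])
  then have 2: "su_eqn_deriv p (V0 + p ** N) = u"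
    using V0 linear_add[OF has_derivative_linear[OF has_derivative_su_eqn[OF S]]] by simp
  show "w \<in> range (\<lambda>V. (su_eqn_deriv p V, coeff_deriv p V))"
    by (rule range_eqI[of _ _ "V0 + p ** N"]) (simp add: w(1) 1 2)
qed

lemma tangent_space_zero_set:
  assumes p: "p \<in> zero_set"
  shows "tangent_space zero_set p = {V \<in> tangent_space special_unitary p. coeff_deriv p V = 0}"
proof -
  have S: "p \<in> special_unitary" using p by (rule zero_setD)
  have p': "p \<in> det_domain" "eqns p = 0" using p zero_set_level_set by auto
  have "tangent_space zero_set p = {V. (su_eqn_deriv p V, coeff_deriv p V) = 0}"
    unfolding zero_set_level_set
    by (rule tangent_space_level_set[OF smooth_eqns subspace_eqns_range eqns_in_range p'
          has_derivative_eqns[OF S] eqns_surj[OF p]])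
  then show ?thesis
    using su_eqn_deriv_eq_0_iff[OF S] tangent_space_special_unitary[OF S] by (auto simp: zero_prod_def)
qed

lemma embedded_zero_set:
  "embedded_submanifold (DIM('n cmat) - dim ((su_eqn_range :: ('n cmat \<times> real) set) \<times> (UNIV :: complex set))) zero_set"
  unfolding zero_set_level_set
proof (rule embedded_submanifold_level_set[OF smooth_eqns subspace_eqns_range eqns_in_range])
  fix p assume "p \<in> det_domain" "eqns p = 0"
  then have p: "p \<in> zero_set" by (simp add: zero_set_level_set)
  show "(eqns has_derivative (\<lambda>V. (su_eqn_deriv p V, coeff_deriv p V))) (at p)"
    by (rule has_derivative_eqns[OF zero_setD(1)[OF p]])
  show "su_eqn_range \<times> UNIV \<subseteq> range (\<lambda>V. (su_eqn_deriv p V, coeff_deriv p V))"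
    by (rule eqns_surj[OF p])
qed

lemma dim_eqns_range:
  "dim ((su_eqn_range :: ('n cmat \<times> real) set) \<times> (UNIV :: complex set)) =
     dim (su_eqn_range :: ('n cmat \<times> real) set) + 2"
  by (subst dim_Times[OF subspace_su_eqn_range subspace_UNIV]) simp

text \<open>
  The dimension of the zero set is a truncated difference of natural numbers. A linear surjection onto the range
  of the equations shows that nothing is truncated, also when the zero set is empty.
\<close>

lemma dim_eqns_range_le:
  "dim ((su_eqn_range :: ('n cmat \<times> real) set) \<times> (UNIV :: complex set)) \<le> DIM('n cmat)"
proof -
  \<comment> \<open>On Hermitian matrices, multiples of the identity and off-diagonal skew matrices the three components
    of \<open>D\<close> can be prescribed independently.\<close>
  define D :: "'n cmat \<Rightarrow> ('n cmat \<times> real) \<times> complex" where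
    "D z = ((z + ct z, Im (trace z)), z $ a $ b - cnj (z $ b $ a))" for z
  have lin: "linear D"
    by (rule linearI) (simp_all add: D_def ct_add ct_scaleR trace_simps algebra_simps)
  have "su_eqn_range \<times> UNIV \<subseteq> range D"
  proof
    fix w assume "w \<in> (su_eqn_range :: ('n cmat \<times> real) set) \<times> (UNIV :: complex set)"
    then obtain A r c where w: "w = ((A, r), c)" "ct A = A" by (auto simp: su_eqn_range_def)
    define z where "z = (1/2) *\<^sub>R A + mat (\<i> * (r / CARD('n))) +
        (mat (c / 2) ** unit_mat a b - mat (cnj c / 2) ** unit_mat b a)"
    have sym: "cnj (A $ j $ i) = A $ i $ j" for i j using w(2) ct_nth by metis
    have "cnj (trace A) = trace A" using w(2) trace_simps(7) by metis
    then have im: "Im (trace A) = 0" by (simp add: complex_eq_iff)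
    have tu: "trace (unit_mat i j :: 'n cmat) = (if i = j then 1 else 0)" for i j
      using trace_unit_mat_mult[of i j "mat 1"] by (auto simp: mat_nth)
    have "ct z = (1/2) *\<^sub>R A - mat (\<i> * (r / CARD('n))) +
        (mat (cnj c / 2) ** unit_mat b a - mat (c / 2) ** unit_mat a b)"
      by (simp add: z_def ct_add ct_diff ct_scaleR ct_mat ct_mat_mult ct_unit_mat w(2)
          linear_neg[OF bounded_linear.linear[OF bounded_linear_mat]])
    then have "z + ct z = (1/2) *\<^sub>R A + (1/2) *\<^sub>R A" by (simp add: z_def)
    then have "z + ct z = A" by (simp flip: scaleR_add_left)
    moreover have "Im (trace z) = r"
      using im ab by (simp add: z_def trace_simps trace_mat_mult tu)
    moreover have "z $ a $ b - cnj (z $ b $ a) = c"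
      using ab by (simp add: z_def mat_nth mat_mult_nth unit_mat_nth sym)
    ultimately show "w \<in> range D" unfolding w(1) by (intro range_eqI[of _ _ z]) (simp add: D_def)
  qed
  then have "dim ((su_eqn_range :: ('n cmat \<times> real) set) \<times> (UNIV :: complex set)) \<le> dim (range D)"
    by (rule dim_subset)
  then show ?thesis using dim_kernel_plus_dim_range[OF lin] by simp
qed

lemma submanifold_zero_set: "submanifold_of_codim 2 special_unitary zero_set"
  unfolding submanifold_of_codim_def
proof
  show "zero_set \<subseteq> special_unitary" by (auto simp: zero_set_def)
  define d where "d = DIM('n cmat) - dim ((su_eqn_range :: ('n cmat \<times> real) set) \<times> (UNIV :: complex set))"
  have "d + 2 = DIM('n cmat) - dim (su_eqn_range :: ('n cmat \<times> real) set)"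
    using dim_eqns_range dim_eqns_range_le unfolding d_def by linarith
  then show "\<exists>d. embedded_submanifold (d + 2) (special_unitary :: 'n cmat set) \<and> embedded_submanifold d zero_set"
    using embedded_zero_set embedded_special_unitary[where 'n = 'n] unfolding d_def[symmetric] by metis
qed

lemma compact_zero_set: "compact zero_set"
proof -
  have "closed {z. coeff z = 0}"
    by (intro closed_Collect_eq continuous_on_const Ck_on_imp_continuous_on[of 0] Ck_on_coeff open_UNIV)
  from compact_Int_closed[OF compact_special_unitary this] show ?thesis
    by (simp add: zero_set_def Int_def)
qed

text \<open>
  At each point \<open>q\<close> of the zero set, the left translate of \<open>\<xi> = p\<^sup>* v\<close> has to be projected off the normal directions.
  Multiplying the projection by the squared length of the gradient, which may vanish away from the zero
  set, clears the denominator. The result is a polynomial in the entries of \<open>q\<close> and their conjugates, defined everywhere.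
\<close>

lemma extension_field_zero_set:
  assumes p: "p \<in> zero_set" and v: "v \<in> tangent_space zero_set p"
  shows "\<exists>X. vector_field special_unitary X \<and> (\<forall>q\<in>zero_set. X q \<in> tangent_space zero_set q) \<and> X p = v"
proof -
  have S: "p \<in> special_unitary" using p by (rule zero_setD)
  define \<xi> where "\<xi> = ct p ** v"
  have \<xi>: "\<xi> \<in> su" "coeff_deriv p v = 0"
    using v unfolding \<xi>_def tangent_space_zero_set[OF p] tangent_space_special_unitary[OF S] by auto
  have vp: "v = p ** \<xi>" by (simp add: \<xi>_def mult_ct_cancel[OF S])
  define X where "X q = (1 / (grad p \<bullet> grad p)) *\<^sub>R
      (q ** ((grad q \<bullet> grad q) *\<^sub>R \<xi> - normal_mat (grad q) (trace (ct (grad q) ** \<xi>))))" for q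
  have N: "normal_mat (grad q) \<zeta> \<in> su" for q \<zeta>
    unfolding grad_def by (rule normal_mat_su[OF trace_grad_mat])
  have arg: "(grad q \<bullet> grad q) *\<^sub>R \<xi> - normal_mat (grad q) (trace (ct (grad q) ** \<xi>)) \<in> su" for q
    by (intro subspace_diff subspace_scale subspace_su \<xi> N)
  have Xmult: "X q = q ** ((1 / (grad p \<bullet> grad p)) *\<^sub>R
      ((grad q \<bullet> grad q) *\<^sub>R \<xi> - normal_mat (grad q) (trace (ct (grad q) ** \<xi>))))" for q
    unfolding X_def by (simp add: matrix_mult_simps)
  have XT: "X q \<in> tangent_space special_unitary q" if q: "q \<in> special_unitary" for q
    unfolding tangent_space_special_unitary[OF q] Xmult
    using subspace_scale[OF subspace_su arg] by (simp add: ct_mult_cancel[OF q])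
  have Ck_grad: "Ck_on k UNIV grad" for k
    unfolding grad_def[abs_def] grad_mat_def
    by (intro Ck_on_diff Ck_on_matrix_mult Ck_on_ct Ck_on_conj_mat Ck_on_const open_UNIV)
  have "Ck_on k UNIV X" for k
    unfolding X_def[abs_def] normal_mat_def
    by (intro Ck_on_bilinear[OF open_UNIV bounded_bilinear_scaleR] Ck_on_bilinear[OF open_UNIV bounded_bilinear_inner]
        Ck_on_diff Ck_on_matrix_mult Ck_on_ct Ck_grad Ck_on_ident Ck_on_const open_UNIV
        Ck_on_linear_compose[OF open_UNIV bounded_linear_mat]
        Ck_on_linear_compose[OF open_UNIV bounded_linear_trace] Ck_on_linear_compose[OF open_UNIV bounded_linear_cnj])
  then have vf: "vector_field special_unitary X"
    unfolding vector_field_def using smooth_map_onI[OF open_UNIV _ subset_UNIV] XT by blast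
  moreover have "X q \<in> tangent_space zero_set q" if q: "q \<in> zero_set" for q
  proof -
    have Sq: "q \<in> special_unitary" using q by (rule zero_setD)
    have "trace (ct (grad q) ** ((grad q \<bullet> grad q) *\<^sub>R \<xi> - normal_mat (grad q) (trace (ct (grad q) ** \<xi>)))) = 0"
      using trace_ct_grad_mat_normal_mat[OF ab zero_setD(2)[OF q]]
      unfolding grad_def[symmetric] by (simp add: matrix_mult_simps trace_simps)
    then have "coeff_deriv q (X q) = 0"
      unfolding Xmult coeff_deriv_mult[OF Sq subspace_scale[OF subspace_su arg]] by (simp add: matrix_mult_simps trace_simps)
    then show ?thesis unfolding tangent_space_zero_set[OF q] using XT[OF Sq] by simp
  qed
  moreover have "X p = v"
  proof -
    have "trace (ct (grad p) ** \<xi>) = 0" using \<xi>(2) coeff_deriv_mult[OF S \<xi>(1)] vp by simp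
    then have "normal_mat (grad p) (trace (ct (grad p) ** \<xi>)) = 0"
      by (simp add: normal_mat_def vec_eq_iff mat_mult_nth)
    then show ?thesis using grad_nonzero[OF p] unfolding X_def by (simp add: matrix_mult_simps vp)
  qed
  ultimately show ?thesis by blast
qed

text \<open>
  Along a curve in the zero set the function \<open>coeff_deriv q (Y q)\<close> is zero. Its derivative relates the value of
  \<open>coeff_deriv p\<close> on the ordinary derivative \<open>D v\<close> of \<open>Y\<close> to \<open>v\<^sup>* K v\<close>. The tangential part of \<open>D v\<close> is
  \<open>D v - p \<xi> \<xi>\<close>, where \<open>v = p \<xi>\<close>, because \<open>\<xi> \<xi>\<close> is Hermitian.
\<close>

lemma hessian_zero_set:
  assumes p: "p \<in> zero_set" and X: "vector_field special_unitary X" and Y: "vector_field special_unitary Y"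
    and tan: "\<forall>q\<in>zero_set. X q \<in> tangent_space zero_set q \<and> Y q \<in> tangent_space zero_set q"
    and eq: "X p = Y p"
  shows "coeff_deriv p (SU.connection X Y p) = - double_comm (conj_mat p) (ct p ** X p) $ a $ b"
proof -
  have S: "p \<in> special_unitary" using p by (rule zero_setD)
  define v where "v = X p"
  define \<xi> where "\<xi> = ct p ** v"
  define B where "B = conj_mat p"
  obtain D where D: "(Y has_derivative D) (at p within special_unitary)"
    using SU.vector_field_derivative[OF Y S] by blast
  have vM: "v \<in> tangent_space zero_set p" using tan p unfolding v_def by blast
  then have vS: "v \<in> tangent_space special_unitary p" unfolding tangent_space_zero_set[OF p] by blast
  then have \<xi>: "ct \<xi> = - \<xi>" "\<xi> \<in> su"
    unfolding tangent_space_special_unitary[OF S] \<xi>_def by (auto simp: su_def)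
  have vp: "v = p ** \<xi>" by (simp add: \<xi>_def mult_ct_cancel[OF S])
  obtain c where c: "c 0 = p" "\<And>t::real. c t \<in> zero_set" "(c has_vector_derivative v) (at 0)"
    using vM unfolding tangent_space_def by blast
  have cS: "c t \<in> special_unitary" for t using c(2) by (rule zero_setD)
  have dY: "((\<lambda>t. Y (c t)) has_vector_derivative D v) (at 0)"
    by (rule has_vector_derivative_along_curve[OF D c(1) cS c(3)])
  note mult_deriv = bounded_bilinear.has_vector_derivative[OF bounded_bilinear_matrix_mult]
  note lin_deriv = bounded_linear.has_vector_derivative
  have "((\<lambda>t. coeff_deriv (c t) (Y (c t))) has_vector_derivative
      ((ct (Y (c 0)) ** (K ** v) + ct (D v) ** (K ** c 0)) + (ct (c 0) ** (K ** D v) + ct v ** (K ** Y (c 0)))) $ a $ b) (at 0)"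
    unfolding coeff_deriv_def
    by (intro lin_deriv[OF bounded_linear_nth] has_vector_derivative_add mult_deriv
        lin_deriv[OF bounded_linear_ct] lin_deriv[OF bounded_linear_mult_left] dY c(3))
  moreover have "coeff_deriv (c t) (Y (c t)) = 0" for t
    using tan c(2)[of t] tangent_space_zero_set[OF c(2)] by blast
  ultimately have "((\<lambda>t. 0) has_vector_derivative
      ((ct v ** (K ** v) + ct (D v) ** (K ** p)) + (ct p ** (K ** D v) + ct v ** (K ** v))) $ a $ b) (at (0::real))"
    by (simp only: c(1) eq[symmetric] v_def[symmetric])
  from vector_derivative_unique_at[OF this has_vector_derivative_const]
  have "((ct v ** (K ** v) + ct (D v) ** (K ** p)) + (ct p ** (K ** D v) + ct v ** (K ** v))) $ a $ b = 0" .
  then have DD: "coeff_deriv p (D v) = - 2 * (ct v ** (K ** v)) $ a $ b"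
    unfolding coeff_deriv_def by (simp add: algebra_simps eq_neg_iff_add_eq_0)
  have vKv: "ct v ** (K ** v) = - (\<xi> ** (B ** \<xi>))"
    unfolding vp ct_mult \<xi>(1) B_def conj_mat_def by (simp add: matrix_mult_simps matrix_mul_assoc)
  have "ct v ** Y p + ct p ** D v \<in> su"
    by (rule field_derivative_special_unitary[OF S SU.vector_field_tangent[OF Y] D vS])
  moreover have "ct v ** Y p = - (\<xi> ** \<xi>)"
    unfolding eq[symmetric] v_def[symmetric] vp ct_mult \<xi>(1)
    by (simp add: matrix_mult_simps matrix_mul_assoc[symmetric] ct_mult_cancel[OF S])
  ultimately have s: "ct p ** D v - \<xi> ** \<xi> \<in> su" by simp
  have "su_proj (ct p ** D v) = su_proj (ct p ** D v - \<xi> ** \<xi>) + su_proj (\<xi> ** \<xi>)"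
    by (simp add: linear_diff[OF bounded_linear.linear[OF bounded_linear_su_proj]])
  also have "su_proj (\<xi> ** \<xi>) = 0" by (rule su_proj_hermitian) (simp add: ct_mult \<xi>(1) matrix_mult_simps)
  finally have "su_proj (ct p ** D v) = ct p ** D v - \<xi> ** \<xi>" by (simp add: su_proj_su[OF s])
  then have "SU.connection X Y p = D v - p ** (\<xi> ** \<xi>)"
    using SU.connection_eq[where X = X, OF D] vS
    by (simp add: v_def[symmetric] su_tangent_proj_def matrix_mult_simps mult_ct_cancel[OF S])
  then have "coeff_deriv p (SU.connection X Y p) = coeff_deriv p (D v) - coeff_deriv p (p ** (\<xi> ** \<xi>))"
    by (simp add: linear_diff[OF linear_coeff_deriv])
  also have "coeff_deriv p (p ** (\<xi> ** \<xi>)) = (\<xi> ** (\<xi> ** B) + B ** (\<xi> ** \<xi>)) $ a $ b"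
    unfolding coeff_deriv_def B_def conj_mat_def
    by (simp add: ct_mult \<xi>(1) matrix_mult_simps matrix_mul_assoc)
  also have "coeff_deriv p (D v) - (\<xi> ** (\<xi> ** B) + B ** (\<xi> ** \<xi>)) $ a $ b = - double_comm B \<xi> $ a $ b"
    unfolding DD vKv double_comm_def by (simp add: matrix_mult_simps matrix_mul_assoc)
  finally show ?thesis by (simp add: B_def \<xi>_def v_def)
qed

lemma minimal_zero_set: "minimal_in special_unitary special_unitary_metric zero_set"
  unfolding minimal_in_def
proof
  fix p assume p: "p \<in> zero_set"
  have S: "p \<in> special_unitary" using p by (rule zero_setD)
  have TS: "subspace (tangent_space special_unitary p)" by (rule subspace_tangent_special_unitary[OF S])
  have lc: "levi_civita special_unitary special_unitary_metric X Y p = SU.connection X Y p"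
    if "vector_field special_unitary X" "vector_field special_unitary Y" for X Y
    by (rule SU.levi_civita_eq[OF special_unitary_metric_eq_inner that S])
  show "mean_curvature special_unitary special_unitary_metric zero_set p = 0"
  proof (rule mean_curvature_eq_0I[where dF = "coeff_deriv p" and g = special_unitary_metric
        and h = "\<lambda>v. - double_comm (conj_mat p) (ct p ** v) $ a $ b"])
    show "subspace (tangent_space special_unitary p)" by (rule TS)
    show "special_unitary_metric p u v = u \<bullet> v" for u v by (rule special_unitary_metric_eq_inner[OF S])
    show "linear (coeff_deriv p)" by (rule linear_coeff_deriv)
    show "tangent_space zero_set p = {v \<in> tangent_space special_unitary p. coeff_deriv p v = 0}"
      by (rule tangent_space_zero_set[OF p])
    show "\<exists>X. vector_field special_unitary X \<and> (\<forall>q\<in>zero_set. X q \<in> tangent_space zero_set q) \<and> X p = v"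
      if "v \<in> tangent_space zero_set p" for v by (rule extension_field_zero_set[OF p that])
    show "subspace (tangent_space zero_set p)"
      unfolding tangent_space_zero_set[OF p]
      using subspace_inter[OF TS linear_subspace_kernel[OF linear_coeff_deriv]] by (simp add: Int_def)
    show "levi_civita special_unitary special_unitary_metric X Y p \<in> tangent_space special_unitary p"
      if "vector_field special_unitary X" "vector_field special_unitary Y" for X Y
      unfolding lc[OF that] using SU.vector_field_tangent[OF SU.vector_field_connection[OF that] S] .
    show "coeff_deriv p (levi_civita special_unitary special_unitary_metric X Y p) =
        - double_comm (conj_mat p) (ct p ** X p) $ a $ b"
      if "vector_field special_unitary X" "vector_field special_unitary Y"
        "\<forall>q\<in>zero_set. X q \<in> tangent_space zero_set q \<and> Y q \<in> tangent_space zero_set q" "X p = Y p" for X Y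
      unfolding lc[OF that(1,2)] by (rule hessian_zero_set[OF p that])
    fix E :: "'n cmat set"
    assume E: "finite E" "span E = tangent_space zero_set p"
      "\<And>u v. u \<in> E \<Longrightarrow> v \<in> E \<Longrightarrow> u \<bullet> v = (if u = v then 1 else 0)"
    define f where "f v = ct p ** v" for v :: "'n cmat"
    have inj: "inj_on f E" by (rule inj_on_inverseI[of _ "\<lambda>Y. p ** Y"]) (simp add: f_def mult_ct_cancel[OF S])
    have inner_f: "f u \<bullet> f v = u \<bullet> v" for u v
      by (simp add: f_def inner_mult_left mult_ct_cancel[OF S])
    have lin: "linear f" unfolding f_def[abs_def] by (rule bounded_linear.linear[OF bounded_linear_mult_left])
    have "span (f ` E) = f ` tangent_space zero_set p"
      unfolding E(2)[symmetric] by (rule linear_span_image[OF lin])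
    also have "\<dots> = {Y\<in>su. trace (ct (grad p) ** Y) = 0}"
    proof (intro equalityI subsetI)
      fix Y assume "Y \<in> f ` tangent_space zero_set p"
      then obtain v where v: "Y = ct p ** v" "ct p ** v \<in> su" "coeff_deriv p v = 0"
        unfolding tangent_space_zero_set[OF p] tangent_space_special_unitary[OF S] f_def by blast
      then have "v = p ** Y" by (simp add: mult_ct_cancel[OF S])
      then show "Y \<in> {Y\<in>su. trace (ct (grad p) ** Y) = 0}"
        using v(2,3) coeff_deriv_mult[OF S v(2)] unfolding v(1) by (simp add: mult_ct_cancel[OF S])
    next
      fix Y assume Y: "Y \<in> {Y\<in>su. trace (ct (grad p) ** Y) = 0}"
      then have "p ** Y \<in> tangent_space zero_set p"
        unfolding tangent_space_zero_set[OF p] tangent_space_special_unitary[OF S]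
        using coeff_deriv_mult[OF S] by (simp add: ct_mult_cancel[OF S])
      moreover have "Y = f (p ** Y)" by (simp add: f_def ct_mult_cancel[OF S])
      ultimately show "Y \<in> f ` tangent_space zero_set p" by blast
    qed
    finally have span: "span (f ` E) = {Y\<in>su. trace (ct (grad p) ** Y) = 0}" .
    have "(\<Sum>Y\<in>f ` E. double_comm (conj_mat p) Y $ a $ b) = 0"
    proof (rule sum_double_comm_orthonormal[OF ab zero_setD(2)[OF p]], fold grad_def)
      show "u \<bullet> v = (if u = v then 1 else 0)" if "u \<in> f ` E" "v \<in> f ` E" for u v
        using that E(3) inner_f inj_onD[OF inj] by auto
    qed (use grad_nonzero[OF p] E(1) span in auto)
    then have "(\<Sum>v\<in>E. double_comm (conj_mat p) (f v) $ a $ b) = 0"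
      by (simp only: sum.reindex[OF inj] o_def)
    then show "(\<Sum>v\<in>E. - double_comm (conj_mat p) (ct p ** v) $ a $ b) = 0"
      by (simp add: f_def sum_negf)
  qed
qed

end

lemma conj_bilinear_value:
  "bilinear_value (column a z) H (conjugate_vector (column b z)) =
    cnj ((ct z ** (\<chi> i j. cnj (H $ i $ j)) ** z) $ a $ b)"
proof -
  have "bilinear_value (column a z) H (conjugate_vector (column b z)) =
      (\<Sum>i\<in>UNIV. \<Sum>j\<in>UNIV. z $ i $ a * H $ i $ j * cnj (z $ j $ b))"
    by (simp add: bilinear_value_def conjugate_vector_def column_def matrix_vector_mult_def sum_distrib_left mult.assoc)
  also have "\<dots> = cnj ((ct z ** ((\<chi> i j. cnj (H $ i $ j)) ** z)) $ a $ b)"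
    by (simp add: mult_nth sum_distrib_left mult.assoc)
  finally show ?thesis by (simp add: matrix_mul_assoc)
qed

lemma eigenvalues_conj: "eigenvalues (\<chi> i j. cnj (H $ i $ j)) = cnj ` eigenvalues (H :: complex^'n^'n)"
proof -
  have sub: "cnj ` eigenvalues H \<subseteq> eigenvalues (\<chi> i j. cnj (H $ i $ j))" for H :: "complex^'n^'n"
  proof clarify
    fix c assume "c \<in> eigenvalues H"
    then obtain v where v: "v \<noteq> 0" "H *v v = c *s v" by (auto simp: eigenvalues_def)
    have "(\<chi> i j. cnj (H $ i $ j)) *v conjugate_vector v = conjugate_vector (H *v v)"
      by (simp add: vec_eq_iff conjugate_vector_def matrix_vector_mult_def)
    also have "\<dots> = cnj c *s conjugate_vector v" unfolding v(2) by (simp add: vec_eq_iff conjugate_vector_def)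
    finally have "(\<chi> i j. cnj (H $ i $ j)) *v conjugate_vector v = cnj c *s conjugate_vector v" .
    moreover have "conjugate_vector v \<noteq> 0" using v(1) by (simp add: vec_eq_iff conjugate_vector_def)
    ultimately show "cnj c \<in> eigenvalues (\<chi> i j. cnj (H $ i $ j))" by (auto simp: eigenvalues_def)
  qed
  have "c \<in> cnj ` eigenvalues H" if "c \<in> eigenvalues (\<chi> i j. cnj (H $ i $ j))" for c
  proof -
    have "cnj c \<in> eigenvalues (\<chi> i j. cnj ((\<chi> i j. cnj (H $ i $ j)) $ i $ j))" using sub that by blast
    then have "cnj c \<in> eigenvalues H" by simp
    then show ?thesis by (rule rev_image_eqI) simp
  qed
  then show ?thesis using sub by blast
qed

theorem theorem1p1:
  fixes H :: "complex^'n^'n"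
    and idx :: "nat \<Rightarrow> 'n"
    and M :: "(complex^'n^'n) set"
  assumes "CARD('n) \<ge> 2"
    and "bij_betw idx {1..CARD('n)} UNIV"
    and "card (eigenvalues H) = CARD('n)"
    and "M = {z \<in> special_unitary.
           bilinear_value (column (idx 1) z) H (conjugate_vector (column (idx 2) z)) = 0}"
  shows "compact M \<and>
         submanifold_of_codim 2 special_unitary M \<and>
         minimal_in special_unitary special_unitary_metric M"
proof -
  define K where "K = (\<chi> i j. cnj (H $ i $ j))"
  have ab: "idx 1 \<noteq> idx 2"
    using assms(1) inj_onD[OF bij_betw_imp_inj_on[OF assms(2)], of 1 2] by auto
  have "card (eigenvalues K) = CARD('n)"
    unfolding K_def eigenvalues_conj using assms(3) by (simp add: card_image inj_on_def)
  then interpret matrix_coefficient K "idx 1" "idx 2"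
    using ab orthogonal_eigenvectors_simple_spectrum by unfold_locales blast+
  have "M = zero_set"
    unfolding assms(4) zero_set_def coeff_def conj_mat_def conj_bilinear_value K_def[symmetric] by simp
  then show ?thesis using compact_zero_set submanifold_zero_set minimal_zero_set by blast
qed

end
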